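(* Consider the FSIPL algorithm described in the context, and assume that its parameter $\alpha$ satisfies $$\alpha>\max\Big\{\frac{M_1}{C_1},\ M_2+\frac{\sigma\hat\tau^2}{2}\Big\},\qquad M_1:=\sqrt{C_2}(\ell_f+\ell_g\ell_{\mathcal A}),\quad M_2:=\kappa(\ell_f+\ell_g\ell_{\mathcal A}),\quad \hat\tau:=\min\Big\{\frac{2\kappa C_1}{\theta L_hC_2},\frac1{C_2}\Big\}.$$ Define, for $t>0$ and $\Delta\ge 0$, $$\hat\eta_1(t,\Delta):=\min\Big\{\frac{\theta}{t(2\ell_f+\ell_g)+\big(\frac{\ell_{\mathcal A}+1}{\sqrt{C_1}}+1\big)\Delta},\,1\Big\},\qquad \hat\eta_2(t,\Delta):=\min\Big\{\hat\eta_1(t,\Delta),\ \frac1{t(L_f+\ell_gL_{\mathcal A}+\alpha L_h+\sigma)}\Big\},$$ $$\hat\tau_2:=\min\Big\{\hat\tau,\ \frac{2(\alpha C_1-M_1)}{\alpha L_hC_2\,\theta/\kappa+\sigma}\Big\},$$ and set $\widetilde\eta:=\gamma\,\hat\eta_2(\overline t,\overline\Delta)$, $\widetilde\tau:=\frac{\gamma}{2}\hat\tau_2$. Then for each $k=0,1,2,\dots$ the inner (backtracking) loop of the algorithm at outer iteration $k$ terminates after at most $$\max\Big\{\Big\lceil\log_{\gamma}\frac{\widetilde\eta}{\overline\eta}\Big\rceil,\ \Big\lceil\log_{\gamma/2}\frac{\widetilde\tau}{\overline\tau}\Big\rceil,\ 0\Big\}$$ inner iterations, where an inner iteration means one rejection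 of a trial point followed by a reduction of the stepsizes.
   Context: Notation. $\|\cdot\|$ is the Euclidean norm (spectral norm for matrices). For a smooth map $\psi:\mathbb R^n\to\mathbb R^m$ with $m$ components, $\nabla\psi(x)\in\mathbb R^{m\times n}$ is its Jacobian; for real-valued $f$, $\nabla f(x)\in\mathbb R^n$ is the gradient. For closed convex $g$ and $t>0$: $M_g^t(x):=\min_y\{g(y)+\frac1{2t}\|y-x\|^2\}$ and $\mathrm{prox}_{tg}(x)$ is the unique minimizer. $\mathcal S$ is the set of nonnegative summable real sequences. Problem. $\mathcal M\subseteq\mathbb R^n$ is a compact embedded submanifold, $\mathcal M_a:=\{x:\mathrm{dist}(x,\mathcal M)\le a\}$, and the problem is $\min_{x\in\mathcal M}F(x):=f(x)+g(\mathcal A(x))$, where $f:\mathbb R^n\to\mathbb R$ and $\mathcal A:\mathbb R^n\to\mathbb R^p$ are continuously differentiable and $g:\mathbb R^p\to\mathbb R$ is closed and convex. Standing assumptions: (i) $\mathcal M=\{x:h(x)=0\}$ for some $h:\mathbb R^n\to\mathbb R^m$, and there is $\kappa>0$ with $\mathrm{dist}(x,\mathcal M)\le\kappa\|h(x)\|$ for all $x\in\mathbb R^n$; (ii) $\nabla h$ is $L_h$-Lipschitz on $\mathbb R^n$, and there are $\theta>0$, $0<C_1\le C_2$ such that for all $x\in\mathcal M_{2\theta}$ the eigenvalues of $\nabla h(x)\nabla h(x)^\top$ lie in $[C_1,C_2]$; (iii) $\nabla f$ is $L_f$-Lipschitz on $\mathbb R^n$; (iv) $g$ is $\ell_g$-Lipschitz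 on $\mathbb R^p$; (v) $\nabla\mathcal A$ is $L_{\mathcal A}$-Lipschitz on $\mathbb R^n$. Constants $\ell_f,\ell_{\mathcal A}>0$ are fixed with $\|\nabla f(x)\|\le\ell_f$ and $\|\nabla\mathcal A(x)\|\le\ell_{\mathcal A}$ for all $x\in\mathcal M_{2\theta}$. $L_h>0$. FSIPL algorithm. Inputs: $x^0\in\mathcal M$, $\gamma\in(0,1)$, $\alpha>0$, positive numbers $\underline t\le\overline t$, $\overline\Delta,\overline\eta,\overline\tau,\sigma$, the constants $\theta,\kappa$ above, and $\{\rho_k\}\in\mathcal S$. Put $N(x):=\frac12\|h(x)\|^2$ (so $\nabla N(x)=\nabla h(x)^\top h(x)$) and $\Phi_\alpha(x):=F(x)+\alpha\|h(x)\|$. For $k=0,1,2,\dots$: 1. Choose $t_k\in[\underline t,\overline t]$, $\Delta_k\in[0,\overline\Delta]$. 2. Find $(\lambda^k,\mu^k)\in\mathbb R^m\times\mathbb R^p$ with $\|\nabla G_k(\lambda^k,\mu^k)\|\le\Delta_k$, where $G_k(\lambda,\mu):=\frac{t_k}2\|\nabla f(x^k)+\nabla h(x^k)^\top\lambda+\nabla\mathcal A(x^k)^\top\mu\|^2+\frac{t_k}2\|\mu\|^2-M_g^{t_k}(\mathcal A(x^k)+t_k\mu)$ (a convex $C^1$ function). 3. Set $d^k:=-t_k(\nabla f(x^k)+\nabla h(x^k)^\top\lambda^k+\nabla\mathcal A(x^k)^\top\mu^k)$ and $v^k:=\mathrm{prox}_{t_kg}(\mathcal A(x^k)+t_k\mu^k)-\mathcal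 A(x^k)$. 4. Set $\eta_k\leftarrow\overline\eta$, $\tau_k\leftarrow\overline\tau$. 5. (Inner loop) Set $y^k:=x^k+\eta_kd^k$, and $\hat x^{k+1}:=y^k-\tau_k\nabla N(y^k)$ if $\|h(y^k)\|\le\theta/\kappa$, otherwise $\hat x^{k+1}:=$ a nearest point of $\mathcal M$ to $y^k$. If $\|h(\hat x^{k+1})\|\le\theta/\kappa$ and $\Phi_\alpha(\hat x^{k+1})\le\Phi_\alpha(x^k)-\frac\sigma2(\eta_k^2\|d^k\|^2+\tau_k^2\|h(y^k)\|)-\frac{\eta_k}{2t_k}\|v^k\|^2+\eta_k(\alpha+\ell_g+\|\lambda^k\|+\|\mu^k\|)\Delta_k+\rho_k$, accept: $x^{k+1}\leftarrow\hat x^{k+1}$ and go to the next $k$. Otherwise reject: $\eta_k\leftarrow\gamma\eta_k$, $\tau_k\leftarrow\frac\gamma2\tau_k$, and repeat step 5. *)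

theory Defs
  imports "HOL-Analysis.Analysis"
begin

definition gradient :: "('a::real_inner \<Rightarrow> real) \<Rightarrow> 'a \<Rightarrow> 'a" where
  "gradient f x = (THE D. GDERIV f x :> D)"

text \<open>The library norm on \<open>real^'n^'m\<close> is the Frobenius norm, so the spectral norm is
  taken as the operator norm of the associated linear map.\<close>

definition spectral_norm :: "real^'n^'m \<Rightarrow> real" where
  "spectral_norm B = onorm (\<lambda>v. B *v v)"

text \<open>Real eigenvalues. It is only applied to symmetric matrices, whose eigenvalues are all
  real.\<close>

definition eigenvalue :: "real^'n^'n \<Rightarrow> real \<Rightarrow> bool" where
  "eigenvalue B e \<longleftrightarrow> (\<exists>v. v \<noteq> 0 \<and> B *v v = e *\<^sub>R v)"

definition tube :: "'a::metric_space set \<Rightarrow> real \<Rightarrow> 'a set" where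
  "tube M a = {x. infdist x M \<le> a}"

definition C1_on :: "'a set \<Rightarrow> ('a::euclidean_space \<Rightarrow> 'b::euclidean_space) \<Rightarrow> bool" where
  "C1_on U f \<longleftrightarrow>
    (\<exists>f' :: 'a \<Rightarrow> 'a \<Rightarrow>\<^sub>L 'b.
      (\<forall>x\<in>U. (f has_derivative blinfun_apply (f' x)) (at x)) \<and> continuous_on U f')"

text \<open>Local slice condition: around each of its points, \<open>M\<close> is straightened to a linear
  subspace \<open>S\<close> by a diffeomorphism between open sets of the ambient space. A single \<open>S\<close> makes
  the dimension constant. Only class \<open>C\<^sup>1\<close> is required, which every smoother notion of embedded
  submanifold entails.\<close>

definition embedded_submanifold :: "'a::euclidean_space set \<Rightarrow> bool" where
  "embedded_submanifold M \<longleftrightarrow>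
    (\<exists>S :: 'a set. subspace S \<and>
      (\<forall>x\<in>M. \<exists>U V \<phi> \<psi>. open U \<and> open V \<and> x \<in> U \<and> homeomorphism U V \<phi> \<psi> \<and>
        C1_on U \<phi> \<and> C1_on V \<psi> \<and> \<phi> ` (M \<inter> U) = S \<inter> V))"

definition nearest_point :: "'a::metric_space set \<Rightarrow> 'a \<Rightarrow> 'a \<Rightarrow> bool" where
  "nearest_point M y z \<longleftrightarrow> is_arg_min (\<lambda>w. dist y w) (\<lambda>w. w \<in> M) z"

definition moreau_env :: "real \<Rightarrow> ('a::real_inner \<Rightarrow> real) \<Rightarrow> 'a \<Rightarrow> real" where
  "moreau_env t g x = (INF y. g y + 1 / (2 * t) * (norm (y - x))\<^sup>2)"

definition prox :: "real \<Rightarrow> ('a::real_inner \<Rightarrow> real) \<Rightarrow> 'a \<Rightarrow> 'a" where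
  "prox t g x = (THE y. is_arg_min (\<lambda>y. g y + 1 / (2 * t) * (norm (y - x))\<^sup>2) (\<lambda>_. True) y)"

definition lagrangian_grad ::
  "(real^'n \<Rightarrow> real) \<Rightarrow> (real^'n \<Rightarrow> real^'m) \<Rightarrow> (real^'n \<Rightarrow> real^'p) \<Rightarrow>
    real^'n \<Rightarrow> real^'m \<Rightarrow> real^'p \<Rightarrow> real^'n" where
  "lagrangian_grad f h A x lam mu =
    gradient f x + transpose (jacobian h (at x)) *v lam + transpose (jacobian A (at x)) *v mu"

definition subproblem_dual ::
  "(real^'n \<Rightarrow> real) \<Rightarrow> (real^'n \<Rightarrow> real^'m) \<Rightarrow> (real^'n \<Rightarrow> real^'p) \<Rightarrow> (real^'p \<Rightarrow> real) \<Rightarrow>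
    real \<Rightarrow> real^'n \<Rightarrow> (real^'m) \<times> (real^'p) \<Rightarrow> real" where
  "subproblem_dual f h A g t x = (\<lambda>(lam, mu).
    t / 2 * (norm (lagrangian_grad f h A x lam mu))\<^sup>2 + t / 2 * (norm mu)\<^sup>2
      - moreau_env t g (A x + t *\<^sub>R mu))"

definition exact_penalty ::
  "(real^'n \<Rightarrow> real) \<Rightarrow> (real^'n \<Rightarrow> real^'m) \<Rightarrow> (real^'n \<Rightarrow> real^'p) \<Rightarrow> (real^'p \<Rightarrow> real) \<Rightarrow>
    real \<Rightarrow> real^'n \<Rightarrow> real" where
  "exact_penalty f h A g alpha x = f x + g (A x) + alpha * norm (h x)"

text \<open>\<open>trial_point M h theta kappa y tau z\<close>: from the intermediate point \<open>y\<close> and stepsize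
  \<open>tau\<close> the method may form the trial point \<open>z\<close>. It is a relation because nearest points of
  \<open>M\<close> need not be unique.\<close>

definition trial_point ::
  "(real^'n) set \<Rightarrow> (real^'n \<Rightarrow> real^'m) \<Rightarrow> real \<Rightarrow> real \<Rightarrow> real^'n \<Rightarrow> real \<Rightarrow> real^'n \<Rightarrow> bool" where
  "trial_point M h theta kappa y tau z \<longleftrightarrow>
    (if norm (h y) \<le> theta / kappa
     then z = y - tau *\<^sub>R gradient (\<lambda>u. 1 / 2 * (norm (h u))\<^sup>2) y
     else nearest_point M y z)"

end

theory Submission
  imports Defs
begin

text \<open>The derivatives of the dual function in \<open>\<lambda>\<close> and \<open>\<mu>\<close> are \<open>- \<nabla>h(x) d\<close> and \<open>v - \<nabla>A(x) d\<close>, so an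
  inexact dual solution yields a direction \<open>d\<close> that is tangent up to \<open>\<Delta>\<close> and a \<open>v\<close> that matches the
  linearization of \<open>A\<close> up to \<open>\<Delta>\<close>. Since \<open>\<mu> - v / t\<close> is a subgradient of \<open>g\<close> at \<open>A(x) + v\<close>, the bound
  \<open>\<parallel>d\<parallel> \<le> t (2 l_f + l_g) + ((l_A + 1) / \<surd>C1 + 1) \<Delta>\<close> follows, and up to a multiple of \<open>\<Delta>\<close> the
  penalty function \<open>\<Phi>\<close> decreases along \<open>d\<close> by the
  descent lemma for \<open>f\<close>, \<open>h\<close> and \<open>A\<close>. The second half of the step decreases \<open>\<Phi>\<close> as well: the
  gradient step contracts \<open>h\<close> because \<open>\<nabla>h \<nabla>h\<^sup>T\<close> has its spectrum in \<open>[C1, C2]\<close>, and the projection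
  moves by at most \<open>\<kappa> \<parallel>h(y)\<parallel>\<close>. Hence every trial point with \<open>\<eta> \<le> \<eta>_tilde\<close> and \<open>\<tau> \<le> \<tau>_tilde\<close> passes the
  test, and the number of rejections is bounded by the number of reductions needed to get there.\<close>

section \<open>Spectral bounds for Gram matrices\<close>

text \<open>Let \<open>s\<close> tend to \<open>0\<close> from the right. The perturbation arguments
  below end this way: minimality along a segment, divided by \<open>s\<close>, bounds the
  first-order term by a multiple of \<open>s\<close>.\<close>

lemma nonpos_if_le_scaled:
  fixes a K :: real
  assumes "\<And>s. 0 < s \<Longrightarrow> s < 1 \<Longrightarrow> a \<le> s * K"
  shows "a \<le> 0"
proof (rule tendsto_lowerbound)
  show "((\<lambda>s. s * K) \<longlongrightarrow> 0) (at_right 0)"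
    by (auto intro!: tendsto_eq_intros)
  have "\<forall>\<^sub>F s in at_right (0::real). s < 1"
    by (rule eventually_at_right_real[THEN eventually_mono]) auto
  then show "\<forall>\<^sub>F s in at_right 0. a \<le> s * K"
    using eventually_at_right_less[of "0::real"]
    by eventually_elim (use assms in auto)
qed simp

lemma le_if_mult_self_le:
  fixes a c :: real
  assumes "a * a \<le> c * a" "0 \<le> c"
  shows "a \<le> c"
proof (cases "0 < a")
  case True
  then show ?thesis using assms(1) by (simp only: mult_le_cancel_right_pos)
qed (use assms(2) in linarith)

lemma norm_matrix_vector_le_spectral_norm:
  fixes B :: "real^'n^'m"
  shows "norm (B *v w) \<le> spectral_norm B * norm w"
  unfolding spectral_norm_def by (rule onorm) (rule matrix_vector_mul_bounded_linear)

lemma inner_transpose_matrix_vector: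
  fixes B :: "real^'n^'m"
  shows "(transpose B *v s) \<bullet> u = s \<bullet> (B *v u)"
  by (simp add: dot_lmul_matrix)

lemma symmetric_rayleigh_lower:
  fixes S :: "real^'m^'m"
  assumes sym: "transpose S = S" and ev: "\<And>e. eigenvalue S e \<Longrightarrow> c \<le> e"
  shows "c * (norm s)\<^sup>2 \<le> (S *v s) \<bullet> s"
proof -
  have symS: "(S *v a) \<bullet> b = (S *v b) \<bullet> a" for a b
    using inner_transpose_matrix_vector[of S a b] sym by (simp add: inner_commute)
  have "continuous_on (sphere 0 1) (\<lambda>u. (S *v u) \<bullet> u)"
    by (intro continuous_intros linear_continuous_on matrix_vector_mul_bounded_linear)
  moreover have "sphere (0::real^'m) 1 \<noteq> {}"
    by (metis norm_axis_1 mem_sphere_0 empty_iff)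
  ultimately obtain u where u: "norm u = 1"
    and umin: "\<And>w. norm w = 1 \<Longrightarrow> (S *v u) \<bullet> u \<le> (S *v w) \<bullet> w"
    using continuous_attains_inf[OF compact_sphere, of 0 1 "\<lambda>u. (S *v u) \<bullet> u"] by auto
  define m where "m = (S *v u) \<bullet> u"
  have ge: "m * (norm w)\<^sup>2 \<le> (S *v w) \<bullet> w" for w
  proof (cases "w = 0")
    case False
    have "m \<le> (S *v (w /\<^sub>R norm w)) \<bullet> (w /\<^sub>R norm w)"
      unfolding m_def by (rule umin) (simp add: False)
    also have "\<dots> = ((S *v w) \<bullet> w) / (norm w)\<^sup>2"
      by (simp add: scaleR_matrix_vector_assoc[symmetric] matrix_vector_mult_scaleR divide_simps power2_eq_square)
    finally show ?thesis using False by (simp add: field_simps)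
  qed simp
  \<comment> \<open>The defect in the eigenvalue equation. Moving \<open>u\<close> along
    \<open>- r\<close> changes the form minus \<open>m\<close> times the squared norm by
    \<open>- 2 * q * (r \<bullet> r)\<close> to first order in \<open>q\<close>, which minimality
    forbids unless \<open>r = 0\<close>.\<close>
  define r where "r = S *v u - m *\<^sub>R u"
  have "2 * (r \<bullet> r) \<le> 0"
  proof (rule nonpos_if_le_scaled)
    fix q :: real assume q: "0 < q" "q < 1"
    have "m * ((norm (u - q *\<^sub>R r))\<^sup>2) \<le> (S *v (u - q *\<^sub>R r)) \<bullet> (u - q *\<^sub>R r)" by (rule ge)
    also have "\<dots> = m - 2 * q * ((S *v u) \<bullet> r) + q\<^sup>2 * ((S *v r) \<bullet> r)"
      using symS[of r u]
      by (simp add: matrix_vector_mult_diff_distrib matrix_vector_mult_scaleR inner_diff_left inner_diff_right m_def power2_eq_square algebra_simps)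
    finally have "m * (norm (u - q *\<^sub>R r))\<^sup>2 \<le> m - 2 * q * ((S *v u) \<bullet> r) + q\<^sup>2 * ((S *v r) \<bullet> r)" .
    moreover have "(norm (u - q *\<^sub>R r))\<^sup>2 = 1 - 2 * q * (u \<bullet> r) + q\<^sup>2 * (r \<bullet> r)"
      using u unfolding power2_norm_eq_inner norm_eq_1
      by (simp add: inner_diff_left inner_diff_right inner_commute power2_eq_square)
    moreover have "(S *v u) \<bullet> r = r \<bullet> r + m * (u \<bullet> r)"
      unfolding r_def by (simp add: inner_diff_left algebra_simps)
    ultimately have "m * (1 - 2 * q * (u \<bullet> r) + q\<^sup>2 * (r \<bullet> r))
        \<le> m - 2 * q * (r \<bullet> r + m * (u \<bullet> r)) + q\<^sup>2 * ((S *v r) \<bullet> r)"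
      by simp
    then have "q * (2 * (r \<bullet> r)) \<le> q * (q * ((S *v r) \<bullet> r - m * (r \<bullet> r)))"
      by (simp add: power2_eq_square algebra_simps)
    then show "2 * (r \<bullet> r) \<le> q * ((S *v r) \<bullet> r - m * (r \<bullet> r))" using q by (simp only: mult_le_cancel_left_pos)
  qed
  then have "r = 0" by (metis inner_gt_zero_iff not_le zero_less_mult_iff zero_less_numeral)
  then have "eigenvalue S m"
    unfolding eigenvalue_def r_def using u by (intro exI[of _ u]) auto
  then have "c \<le> m" by (rule ev)
  then show ?thesis using ge[of s] by (meson mult_right_mono order_trans zero_le_power2)
qed

lemma symmetric_rayleigh_upper:
  fixes S :: "real^'m^'m"
  assumes sym: "transpose S = S" and ev: "\<And>e. eigenvalue S e \<Longrightarrow> e \<le> c"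
  shows "(S *v s) \<bullet> s \<le> c * (norm s)\<^sup>2"
proof -
  have neg: "(- S) *v w = - (S *v w)" for w
    by (metis add.right_inverse add_eq_0_iff matrix_vector_mult_0 matrix_vector_mult_add_rdistrib)
  have "transpose (- S) = - S" using sym by (simp add: transpose_def vec_eq_iff)
  moreover have "- c \<le> e" if "eigenvalue (- S) e" for e
  proof -
    have "eigenvalue S (- e)" using that unfolding eigenvalue_def neg
      by (metis scaleR_minus_left minus_equation_iff)
    then show ?thesis using ev by fastforce
  qed
  ultimately have "- c * (norm s)\<^sup>2 \<le> ((- S) *v s) \<bullet> s" by (rule symmetric_rayleigh_lower)
  then show ?thesis by (simp add: neg)
qed

text \<open>Positivity of \<open>P\<close> is tested at \<open>c' *\<^sub>R s - P s\<close>, and the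
  upper bound is used at both \<open>s\<close> and \<open>P s\<close>; the mixed terms collapse to a
  comparison of the squares of \<open>norm (P s)\<close> and \<open>c' * norm s\<close>.\<close>

lemma symmetric_norm_le:
  fixes P :: "'a::real_inner \<Rightarrow> 'a"
  assumes lin: "linear P" and sym: "\<And>a b. P a \<bullet> b = a \<bullet> P b"
    and pos: "\<And>a. 0 \<le> P a \<bullet> a" and le: "\<And>a. P a \<bullet> a \<le> c * (norm a)\<^sup>2" and c: "0 \<le> c"
  shows "norm (P s) \<le> c * norm s"
proof -
  \<comment> \<open>The argument divides by \<open>c\<close>, so it is run with every larger \<open>c'\<close>.\<close>
  have *: "norm (P s) \<le> c' * norm s" if c': "c < c'" for c'
  proof -
    have c'pos: "c' > 0" using c c' by simp
    have le': "P a \<bullet> a \<le> c' * (norm a)\<^sup>2" for a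
      using le[of a] c' by (meson less_imp_le mult_right_mono order_trans zero_le_power2)
    have "0 \<le> P (c' *\<^sub>R s - P s) \<bullet> (c' *\<^sub>R s - P s)" by (rule pos)
    also have "\<dots> = c'\<^sup>2 * (P s \<bullet> s) - 2 * c' * (norm (P s))\<^sup>2 + P (P s) \<bullet> P s"
      using sym[of "P s" s]
      by (simp add: linear_diff[OF lin] linear_cmul[OF lin] inner_diff_left inner_diff_right
          dot_square_norm inner_commute power2_eq_square algebra_simps)
    also have "\<dots> \<le> c'\<^sup>2 * (c' * (norm s)\<^sup>2) - 2 * c' * (norm (P s))\<^sup>2 + c' * (norm (P s))\<^sup>2"
      using le'[of s] le'[of "P s"] c'pos by (intro add_mono diff_mono mult_left_mono) auto
    also have "\<dots> = c' * ((c' * norm s)\<^sup>2 - (norm (P s))\<^sup>2)"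
      by (simp add: power2_eq_square algebra_simps)
    finally have "(norm (P s))\<^sup>2 \<le> (c' * norm s)\<^sup>2" using c'pos by (simp add: zero_le_mult_iff)
    then show ?thesis using c'pos by (meson power2_le_imp_le less_imp_le mult_nonneg_nonneg norm_ge_zero)
  qed
  have "norm (P s) - c * norm s \<le> 0"
  proof (rule nonpos_if_le_scaled)
    fix q :: real assume "0 < q" "q < 1"
    then show "norm (P s) - c * norm s \<le> q * norm s"
      using *[of "c + q"] by (simp add: algebra_simps)
  qed
  then show ?thesis by simp
qed

section \<open>Gram matrices with spectrum in an interval\<close>

context
  fixes B :: "real^'n^'m" and C1 C2 :: real
  assumes ev: "\<And>e. eigenvalue (B ** transpose B) e \<Longrightarrow> e \<in> {C1..C2}"
begin

lemma gram_inner: "(B *v (transpose B *v s)) \<bullet> w = (transpose B *v s) \<bullet> (transpose B *v w)"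
  by (metis inner_commute inner_transpose_matrix_vector)

lemma gram_lower: "C1 * (norm s)\<^sup>2 \<le> (norm (transpose B *v s))\<^sup>2"
  and gram_upper: "(norm (transpose B *v s))\<^sup>2 \<le> C2 * (norm s)\<^sup>2"
proof -
  have sym: "transpose (B ** transpose B) = B ** transpose B"
    by (simp add: matrix_transpose_mul)
  have eq: "((B ** transpose B) *v s) \<bullet> s = (norm (transpose B *v s))\<^sup>2"
    using gram_inner[of s s] by (simp add: power2_norm_eq_inner matrix_vector_mul_assoc[symmetric])
  show "C1 * (norm s)\<^sup>2 \<le> (norm (transpose B *v s))\<^sup>2"
    using symmetric_rayleigh_lower[OF sym, of C1 s] ev eq by auto
  show "(norm (transpose B *v s))\<^sup>2 \<le> C2 * (norm s)\<^sup>2"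
    using symmetric_rayleigh_upper[OF sym, of C2 s] ev eq by auto
qed

text \<open>The step condition \<open>tau * C2 \<le> 1\<close> makes the symmetric map positive, and
  \<open>C1\<close> bounds its quadratic form by \<open>1 - tau * C1\<close>. With \<open>B\<close>
  the Jacobian of \<open>h\<close>, this is the linearized effect of a gradient step on the
  constraint value.\<close>

lemma gram_contraction:
  assumes "0 \<le> C1" "C1 \<le> C2" "0 \<le> tau" "tau * C2 \<le> 1"
  shows "norm (s - tau *\<^sub>R (B *v (transpose B *v s))) \<le> (1 - tau * C1) * norm s"
proof (rule symmetric_norm_le[where P = "\<lambda>s. s - tau *\<^sub>R (B *v (transpose B *v s))"])
  show "linear (\<lambda>s. s - tau *\<^sub>R (B *v (transpose B *v s)))"
    by (rule linearI) (simp_all del: transpose_matrix_vector add: matrix_vector_right_distrib matrix_vector_mult_scaleR algebra_simps)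
next
  fix a
  have eq: "(a - tau *\<^sub>R (B *v (transpose B *v a))) \<bullet> a = (norm a)\<^sup>2 - tau * (norm (transpose B *v a))\<^sup>2"
    by (simp del: transpose_matrix_vector add: inner_diff_left gram_inner power2_norm_eq_inner)
  have "tau * (norm (transpose B *v a))\<^sup>2 \<le> tau * (C2 * (norm a)\<^sup>2)"
    using gram_upper assms by (intro mult_left_mono)
  also have "\<dots> \<le> 1 * (norm a)\<^sup>2"
    using mult_right_mono[OF assms(4), of "(norm a)\<^sup>2"] by (simp add: mult.assoc)
  finally show "0 \<le> (a - tau *\<^sub>R (B *v (transpose B *v a))) \<bullet> a" unfolding eq by simp
  have "tau * (C1 * (norm a)\<^sup>2) \<le> tau * (norm (transpose B *v a))\<^sup>2"
    using gram_lower assms by (intro mult_left_mono)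
  then show "(a - tau *\<^sub>R (B *v (transpose B *v a))) \<bullet> a \<le> (1 - tau * C1) * (norm a)\<^sup>2"
    unfolding eq by (simp add: algebra_simps)
next
  show "0 \<le> 1 - tau * C1"
    using assms mult_left_mono[OF assms(2,3)] by linarith
qed (simp del: transpose_matrix_vector add: inner_diff_left inner_diff_right gram_inner, metis gram_inner inner_commute)

text \<open>The lower eigenvalue bound makes the Gram map injective, hence onto. The preimage in the
  range of the transpose is the one of least norm; its squared norm is \<open>e \<bullet> s\<close>,
  where \<open>norm s\<close> is at most its norm divided by \<open>sqrt C1\<close>.\<close>

lemma gram_right_inverse:
  assumes "0 < C1"
  obtains s where "B *v (transpose B *v s) = e" and "norm (transpose B *v s) \<le> norm e / sqrt C1"
proof -
  let ?G = "\<lambda>s. B *v (transpose B *v s)"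
  have lin: "linear ?G"
    by (rule linearI) (simp_all del: transpose_matrix_vector add: matrix_vector_right_distrib matrix_vector_mult_scaleR)
  have "s = 0" if "?G s = 0" for s
  proof -
    have "C1 * (norm s)\<^sup>2 \<le> 0"
      using gram_lower[of s] gram_inner[of s s] that by (simp add: power2_norm_eq_inner)
    then show ?thesis using assms by (simp add: mult_le_0_iff)
  qed
  then have "inj ?G" using linear_injective_0[OF lin] by blast
  then have "surj ?G" by (rule linear_injective_imp_surjective[OF lin _ refl])
  from surjD[OF this, of e] obtain s where s: "e = ?G s" by (elim exE) (rule that)
  let ?n = "transpose B *v s"
  have le: "sqrt C1 * norm s \<le> norm ?n"
  proof (rule power2_le_imp_le)
    show "(sqrt C1 * norm s)\<^sup>2 \<le> (norm ?n)\<^sup>2"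
      using gram_lower[of s] assms by (simp add: power_mult_distrib del: transpose_matrix_vector)
  qed (rule norm_ge_zero)
  have "(norm ?n)\<^sup>2 = e \<bullet> s" unfolding s by (simp only: power2_norm_eq_inner gram_inner)
  also have "\<dots> \<le> norm e * norm s" by (rule norm_cauchy_schwarz)
  also have "\<dots> \<le> norm e * (norm ?n / sqrt C1)"
    using le assms by (intro mult_left_mono) (simp_all add: field_simps)
  finally have "norm ?n * norm ?n \<le> (norm e / sqrt C1) * norm ?n" by (simp add: power2_eq_square)
  then have "norm ?n \<le> norm e / sqrt C1"
    by (rule le_if_mult_self_le) (use assms in simp)
  with that[of s] s show thesis by simp
qed

end

section \<open>Derivatives\<close>

lemma norm_linearization_error_le:
  fixes F :: "'a::real_normed_vector \<Rightarrow> 'b::real_inner" and F' :: "'a \<Rightarrow> 'a \<Rightarrow> 'b"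
  assumes der: "\<And>u. (F has_derivative F' u) (at u)"
    and lip: "\<And>u w. norm (F' u w - F' x w) \<le> L * norm (u - x) * norm w"
  shows "norm (F (x + w) - F x - F' x w) \<le> L / 2 * (norm w)\<^sup>2"
proof -
  define e where "e = F (x + w) - F x - F' x w"
  define \<phi> where "\<phi> s = e \<bullet> (F (x + s *\<^sub>R w) - F x - s *\<^sub>R F' x w) - L / 2 * s\<^sup>2 * (norm w)\<^sup>2 * norm e" for s
  have lin: "F' u (s *\<^sub>R w) = s *\<^sub>R F' u w" for u s
    using der has_derivative_linear linear_cmul by blast
  \<comment> \<open>As \<open>\<phi> 0 = 0\<close>, this is the claim multiplied by
    \<open>norm e\<close>.\<close>
  have "\<phi> 1 \<le> \<phi> 0"
  proof (rule DERIV_nonpos_imp_nonincreasing[where f = \<phi>])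
    fix s :: real assume s: "0 \<le> s" "s \<le> 1"
    let ?D = "e \<bullet> (F' (x + s *\<^sub>R w) w - F' x w) - L * s * (norm w)\<^sup>2 * norm e"
    have "((\<lambda>s. F (x + s *\<^sub>R w)) has_derivative (\<lambda>h. F' (x + s *\<^sub>R w) (h *\<^sub>R w))) (at s)"
      by (rule has_derivative_compose[OF _ der, where f = "\<lambda>s. x + s *\<^sub>R w", unfolded o_def]) (auto intro!: derivative_eq_intros)
    then have "(\<phi> has_real_derivative ?D) (at s)"
      unfolding \<phi>_def has_field_derivative_def lin
      by (auto intro!: derivative_eq_intros simp: fun_eq_iff inner_diff_right algebra_simps)
    moreover have "e \<bullet> (F' (x + s *\<^sub>R w) w - F' x w) \<le> norm e * (L * norm (s *\<^sub>R w) * norm w)"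
      using norm_cauchy_schwarz[of e] lip[of "x + s *\<^sub>R w" w]
      by (smt (verit, ccfv_SIG) add_diff_cancel_left' mult_left_mono norm_ge_zero)
    then have "?D \<le> 0" using s by (simp add: power2_eq_square algebra_simps)
    ultimately show "\<exists>y. (\<phi> has_real_derivative y) (at s) \<and> y \<le> 0" by blast
  qed simp
  then have "norm e * norm e \<le> (L / 2 * (norm w)\<^sup>2) * norm e"
    by (simp add: \<phi>_def e_def[symmetric] dot_square_norm power2_eq_square)
  moreover have "0 \<le> L / 2 * (norm w)\<^sup>2"
    using order_trans[OF norm_ge_zero lip[of "x + w" w]] by (simp add: power2_eq_square)
  ultimately show ?thesis unfolding e_def[symmetric] by (rule le_if_mult_self_le)
qed

lemma has_derivative_if_quadratic_error:
  fixes F :: "'a::real_normed_vector \<Rightarrow> 'b::real_normed_vector"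
  assumes "bounded_linear D"
    and err: "\<And>w. norm (F (x + w) - F x - D w) \<le> C * (norm w)\<^sup>2"
  shows "(F has_derivative D) (at x)"
  unfolding has_derivative_at
proof
  show "((\<lambda>w. norm (F (x + w) - F x - D w) / norm w) \<longlongrightarrow> 0) (at 0)"
  proof (rule Lim_null_comparison)
    show "\<forall>\<^sub>F w in at 0. norm (norm (F (x + w) - F x - D w) / norm w) \<le> C * norm w"
      unfolding eventually_at_filter
    proof (rule always_eventually, intro allI impI)
      fix w :: 'a assume "w \<noteq> 0"
      then show "norm (norm (F (x + w) - F x - D w) / norm w) \<le> C * norm w"
        using err[of w] by (simp add: divide_le_eq power2_eq_square mult.assoc)
    qed
    show "((\<lambda>w. C * norm w) \<longlongrightarrow> 0) (at (0::'a))"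
      by (auto intro!: tendsto_eq_intros)
  qed
qed fact

lemma gradient_eqI:
  assumes "GDERIV F x :> D"
  shows "gradient F x = D"
  unfolding gradient_def
proof (rule the_equality[of "\<lambda>D. GDERIV F x :> D", OF assms])
  fix D' assume "GDERIV F x :> D'"
  then have "(\<lambda>w. w \<bullet> D') = (\<lambda>w. w \<bullet> D)"
    using assms has_derivative_unique unfolding gderiv_def by blast
  then show "D' = D" by (metis vector_eq_ldot)
qed

lemma gradient_works:
  fixes F :: "'a::euclidean_space \<Rightarrow> real"
  assumes "F differentiable (at x)"
  shows "GDERIV F x :> gradient F x"
proof -
  obtain F' where F': "(F has_derivative F') (at x)" using assms differentiable_def by blast
  then have "F' = (\<lambda>w. w \<bullet> adjoint F' 1)"
    using adjoint_works[OF has_derivative_linear[OF F'], of _ 1] by (simp add: fun_eq_iff)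
  then have "GDERIV F x :> adjoint F' 1" using F' by (simp add: gderiv_def)
  then show ?thesis using gradient_eqI by metis
qed

section \<open>Moreau envelope and dual function\<close>

context
  fixes g :: "'a::euclidean_space \<Rightarrow> real" and l t :: real
  assumes cvx: "convex_on UNIV g" and lip: "l-lipschitz_on UNIV g" and t: "0 < t"
begin

lemma lipschitz_bound: "g y \<le> g z + l * norm (y - z)"
  using lipschitz_onD[OF lip, of y z] by (simp add: dist_norm)

text \<open>Outside the ball of radius \<open>2 * t * l\<close> around \<open>z\<close> the
  quadratic term exceeds any decrease that the Lipschitz constant allows, so a minimizer on this
  compact ball is a global one.\<close>

lemma prox_minimizer_exists:
  "\<exists>p. \<forall>y. g p + 1 / (2 * t) * (norm (p - z))\<^sup>2 \<le> g y + 1 / (2 * t) * (norm (y - z))\<^sup>2"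
proof -
  let ?F = "\<lambda>y. g y + 1 / (2 * t) * (norm (y - z))\<^sup>2"
  define R where "R = 2 * t * l"
  have l: "0 \<le> l" using lip lipschitz_on_nonneg by blast
  then have R: "0 \<le> R" using t by (simp add: R_def)
  have "continuous_on UNIV g" using lip lipschitz_on_continuous_on by blast
  then have "continuous_on (cball z R) ?F"
    by (intro continuous_intros) (rule continuous_on_subset, auto)
  moreover have "cball z R \<noteq> {}" using R by simp
  ultimately obtain p where p: "\<forall>y\<in>cball z R. ?F p \<le> ?F y"
    using continuous_attains_inf[OF compact_cball, of z R ?F] by blast
  have "?F p \<le> ?F y" for y
  proof (cases "y \<in> cball z R")
    case False
    then have n: "2 * t * l \<le> norm (y - z)" by (simp add: R_def dist_norm norm_minus_commute)
    have "?F p \<le> ?F z" using bspec[OF p, of z] R by simp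
    also have "\<dots> \<le> g y + l * norm (y - z)" using lipschitz_bound[of z y] by (simp add: norm_minus_commute)
    also have "l * norm (y - z) \<le> 1 / (2 * t) * (norm (y - z))\<^sup>2"
      using mult_right_mono[OF n, of "norm (y - z)"] t by (simp add: field_simps power2_eq_square)
    finally show ?thesis by simp
  qed (use p in blast)
  then show ?thesis by blast
qed

text \<open>Optimality condition: compare \<open>p\<close> with the point
  \<open>p + s *\<^sub>R (y - p)\<close>, apply convexity, divide by \<open>s\<close> and let
  \<open>s\<close> tend to \<open>0\<close>.\<close>

lemma prox_minimizer_subgradient:
  assumes min: "\<And>y. g p + 1 / (2 * t) * (norm (p - z))\<^sup>2 \<le> g y + 1 / (2 * t) * (norm (y - z))\<^sup>2"
  shows "g p + ((z - p) \<bullet> (y - p)) / t \<le> g y"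
proof -
  have "g p + ((z - p) \<bullet> (y - p)) / t - g y \<le> 0"
  proof (rule nonpos_if_le_scaled)
    fix s :: real assume s: "0 < s" "s < 1"
    let ?q = "p + s *\<^sub>R (y - p)"
    have q: "?q = (1 - s) *\<^sub>R p + s *\<^sub>R y" by (simp add: algebra_simps)
    have cv: "g ?q \<le> (1 - s) * g p + s * g y"
      unfolding q using cvx s by (intro convex_onD) auto
    have "(norm (?q - z))\<^sup>2 = (norm (p - z))\<^sup>2 - 2 * s * ((z - p) \<bullet> (y - p)) + s\<^sup>2 * (norm (y - p))\<^sup>2"
      unfolding power2_norm_eq_inner
      by (simp add: inner_diff_left inner_diff_right inner_add_left inner_add_right inner_commute power2_eq_square algebra_simps)
    then have "g p + 1 / (2 * t) * (norm (p - z))\<^sup>2 \<le> (1 - s) * g p + s * g y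
        + 1 / (2 * t) * ((norm (p - z))\<^sup>2 - 2 * s * ((z - p) \<bullet> (y - p)) + s\<^sup>2 * (norm (y - p))\<^sup>2)"
      using min[of ?q] cv by simp
    then have "s * (g p + ((z - p) \<bullet> (y - p)) / t - g y) \<le> s * (s * ((norm (y - p))\<^sup>2 / (2 * t)))"
      using t by (simp add: field_simps power2_eq_square)
    then show "g p + ((z - p) \<bullet> (y - p)) / t - g y \<le> s * ((norm (y - p))\<^sup>2 / (2 * t))"
      using s by (simp only: mult_le_cancel_left_pos)
  qed
  then show ?thesis by simp
qed

text \<open>Adding the two subgradient inequalities gives monotonicity. The statement is about
  arbitrary minimizers rather than \<open>prox\<close>, since its case \<open>z' = z\<close>
  supplies the uniqueness that makes \<open>prox\<close> well defined.\<close>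

lemma prox_minimizer_nonexpansive:
  assumes min: "\<And>y. g p + 1 / (2 * t) * (norm (p - z))\<^sup>2 \<le> g y + 1 / (2 * t) * (norm (y - z))\<^sup>2"
    and min': "\<And>y. g p' + 1 / (2 * t) * (norm (p' - z'))\<^sup>2 \<le> g y + 1 / (2 * t) * (norm (y - z'))\<^sup>2"
  shows "norm (p' - p) \<le> norm (z' - z)"
proof -
  have "((z - p) \<bullet> (p' - p)) / t + ((z' - p') \<bullet> (p - p')) / t \<le> 0"
    using prox_minimizer_subgradient[OF min, of p'] prox_minimizer_subgradient[OF min', of p] by simp
  then have "(z - p) \<bullet> (p' - p) + (z' - p') \<bullet> (p - p') \<le> 0"
    using t by (simp add: add_divide_distrib[symmetric] divide_le_0_iff)
  then have "(norm (p' - p))\<^sup>2 \<le> (z' - z) \<bullet> (p' - p)"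
    unfolding power2_norm_eq_inner by (simp add: inner_diff_left inner_diff_right inner_commute)
  also have "\<dots> \<le> norm (z' - z) * norm (p' - p)" by (rule norm_cauchy_schwarz)
  finally show ?thesis by (simp only: power2_eq_square) (rule le_if_mult_self_le, auto)
qed

lemma prox_minimizes:
  "g (prox t g z) + 1 / (2 * t) * (norm (prox t g z - z))\<^sup>2 \<le> g y + 1 / (2 * t) * (norm (y - z))\<^sup>2"
proof -
  obtain p where p: "\<And>y. g p + 1 / (2 * t) * (norm (p - z))\<^sup>2 \<le> g y + 1 / (2 * t) * (norm (y - z))\<^sup>2"
    using prox_minimizer_exists by blast
  have "prox t g z = p"
    unfolding prox_def
  proof (rule the_equality)
    show "is_arg_min (\<lambda>y. g y + 1 / (2 * t) * (norm (y - z))\<^sup>2) (\<lambda>_. True) p"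
      using p by (auto simp: is_arg_min_linorder)
  next
    fix p' assume "is_arg_min (\<lambda>y. g y + 1 / (2 * t) * (norm (y - z))\<^sup>2) (\<lambda>_. True) p'"
    then have "norm (p' - p) \<le> norm (z - z)"
      by (intro prox_minimizer_nonexpansive p) (auto simp: is_arg_min_linorder)
    then show "p' = p" by simp
  qed
  then show ?thesis using p by blast
qed

lemmas prox_subgradient = prox_minimizer_subgradient[OF prox_minimizes]

lemma moreau_env_eq_prox: "moreau_env t g z = g (prox t g z) + 1 / (2 * t) * (norm (prox t g z - z))\<^sup>2"
  unfolding moreau_env_def by (rule cInf_eq_minimum) (use prox_minimizes in auto)

lemma moreau_env_le: "moreau_env t g z \<le> g y + 1 / (2 * t) * (norm (y - z))\<^sup>2"
  unfolding moreau_env_eq_prox by (rule prox_minimizes)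

text \<open>The increment of the envelope is squeezed by testing the old proximal point at
  \<open>z + w\<close> and the new one at \<open>z\<close>. The two bounds differ by a term in
  \<open>?q - ?p\<close>, which is of second order by nonexpansiveness.\<close>

lemma GDERIV_moreau_env: "GDERIV (moreau_env t g) z :> (z - prox t g z) /\<^sub>R t"
  unfolding gderiv_def
proof (rule has_derivative_if_quadratic_error[where C = "1 / (2 * t)"])
  show "bounded_linear (\<lambda>w. w \<bullet> ((z - prox t g z) /\<^sub>R t))" by (rule bounded_linear_inner_left)
next
  fix w
  let ?M = "moreau_env t g" and ?p = "prox t g z" and ?q = "prox t g (z + w)"
  have shift: "(norm (a - (z + w)))\<^sup>2 = (norm (a - z))\<^sup>2 + 2 * (w \<bullet> (z - a)) + (norm w)\<^sup>2" for a
    unfolding power2_norm_eq_inner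
    by (simp add: inner_diff_left inner_diff_right inner_add_left inner_add_right inner_commute)
  have up: "?M (z + w) - ?M z \<le> (w \<bullet> (z - ?p)) / t + (norm w)\<^sup>2 / (2 * t)"
    using moreau_env_le[of "z + w" ?p] moreau_env_eq_prox[of z] t unfolding shift by (simp add: field_simps)
  have low: "(w \<bullet> (z - ?q)) / t + (norm w)\<^sup>2 / (2 * t) \<le> ?M (z + w) - ?M z"
    using moreau_env_le[of z ?q] moreau_env_eq_prox[of "z + w"] t unfolding shift by (simp add: field_simps)
  have "norm (?q - ?p) \<le> norm (z + w - z)"
    by (rule prox_minimizer_nonexpansive; rule prox_minimizes)
  then have "norm w * norm (?q - ?p) \<le> norm w * norm w" by (intro mult_left_mono) auto
  then have "w \<bullet> (?q - ?p) \<le> (norm w)\<^sup>2"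
    using norm_cauchy_schwarz[of w "?q - ?p"] by (simp add: power2_eq_square)
  then have "w \<bullet> (z - ?p) - (norm w)\<^sup>2 \<le> w \<bullet> (z - ?q)" by (simp add: inner_diff_right)
  then have "(w \<bullet> (z - ?p)) / t - (norm w)\<^sup>2 / t \<le> (w \<bullet> (z - ?q)) / t"
    using t by (simp add: diff_divide_distrib[symmetric] divide_right_mono)
  then have "(w \<bullet> (z - ?p)) / t - (norm w)\<^sup>2 / (2 * t) \<le> ?M (z + w) - ?M z"
    using low field_sum_of_halves[of "(norm w)\<^sup>2 / t"] by (simp add: mult.commute)
  moreover have "w \<bullet> ((z - ?p) /\<^sub>R t) = (w \<bullet> (z - ?p)) / t"
    unfolding inner_scaleR_right by (rule divide_inverse_commute[symmetric])
  moreover have "1 / (2 * t) * (norm w)\<^sup>2 = (norm w)\<^sup>2 / (2 * t)" by simp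
  ultimately show "norm (?M (z + w) - ?M z - w \<bullet> ((z - ?p) /\<^sub>R t)) \<le> 1 / (2 * t) * (norm w)\<^sup>2"
    using up unfolding real_norm_def abs_le_iff by linarith
qed

text \<open>The residual divided by \<open>t\<close> is a subgradient of \<open>g\<close> at the
  proximal point, and subgradients of an \<open>l\<close>-Lipschitz function have norm at most
  \<open>l\<close>; testing at \<open>z\<close> itself shows this.\<close>

lemma prox_residual_le: "norm (z - prox t g z) \<le> t * l"
proof -
  let ?p = "prox t g z" and ?r = "z - prox t g z"
  have "g ?p + (?r \<bullet> (z - ?p)) / t \<le> g z" by (rule prox_subgradient)
  also have "\<dots> \<le> g ?p + l * norm ?r" by (rule lipschitz_bound)
  finally have "norm ?r * norm ?r \<le> (t * l) * norm ?r"
    using t by (simp add: field_simps dot_square_norm power2_eq_square)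
  moreover have "0 \<le> t * l" using t lip lipschitz_on_nonneg by (auto intro!: mult_nonneg_nonneg)
  ultimately show ?thesis by (rule le_if_mult_self_le)
qed

end

text \<open>Identifies the stopping test of the dual solver with the residuals of the linearized
  constraints, which is all that the descent analysis uses of dual optimality.\<close>

lemma gradient_subproblem_dual:
  fixes g :: "real^'p \<Rightarrow> real"
  assumes g: "convex_on UNIV g" "l-lipschitz_on UNIV g" and t: "0 < t"
    and d: "d = - t *\<^sub>R lagrangian_grad f h A x lam mu"
    and v: "v = prox t g (A x + t *\<^sub>R mu) - A x"
  shows "gradient (subproblem_dual f h A g t x) (lam, mu)
    = (- (jacobian h (at x) *v d), v - jacobian A (at x) *v d)"
proof (rule gradient_eqI)
  define H where "H = jacobian h (at x)"
  define K where "K = jacobian A (at x)"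
  define w where "w = lagrangian_grad f h A x lam mu"
  define E where "E = (\<lambda>p. lagrangian_grad f h A x (fst p) (snd p))"
  have blin: "bounded_linear (\<lambda>p. transpose H *v fst p + transpose K *v snd p)"
    by (intro bounded_linear_add bounded_linear_compose[OF matrix_vector_mul_bounded_linear]
        bounded_linear_fst bounded_linear_snd)
  have dE: "(E has_derivative (\<lambda>p. transpose H *v fst p + transpose K *v snd p)) (at (lam, mu))"
  proof -
    have "E = (\<lambda>p. gradient f x + (transpose H *v fst p + transpose K *v snd p))"
      by (simp add: E_def lagrangian_grad_def H_def K_def add.assoc)
    then show ?thesis
      using has_derivative_add[OF has_derivative_const bounded_linear_imp_has_derivative[OF blin]] by simp
  qed
  define z where "z = A x + t *\<^sub>R mu"
  define r where "r = (z - prox t g z) /\<^sub>R t"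
  have dM: "(moreau_env t g has_derivative (\<lambda>u. u \<bullet> r)) (at (A x + t *\<^sub>R snd (lam, mu)))"
    using GDERIV_moreau_env[OF g t, of z] by (simp add: gderiv_def z_def r_def)
  have dz: "((\<lambda>p. A x + t *\<^sub>R snd p) has_derivative (\<lambda>p. t *\<^sub>R snd p)) (at (lam, mu))"
    by (auto intro!: derivative_eq_intros)
  have dMz: "((\<lambda>p. moreau_env t g (A x + t *\<^sub>R snd p)) has_derivative (\<lambda>p. (t *\<^sub>R snd p) \<bullet> r)) (at (lam, mu))"
    using has_derivative_compose[OF dz dM] .
  have eq: "subproblem_dual f h A g t x = (\<lambda>p. t / 2 * (E p \<bullet> E p) + t / 2 * (snd p \<bullet> snd p) - moreau_env t g (A x + t *\<^sub>R snd p))"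
    by (simp add: fun_eq_iff subproblem_dual_def E_def power2_norm_eq_inner)
  have Ew: "E (lam, mu) = w" by (simp add: E_def w_def)
  have der: "(subproblem_dual f h A g t x has_derivative
      (\<lambda>p. t * ((transpose H *v fst p + transpose K *v snd p) \<bullet> w) + t * (snd p \<bullet> mu) - (t *\<^sub>R snd p) \<bullet> r)) (at (lam, mu))"
    unfolding eq
    by (rule derivative_eq_intros dE dMz refl | simp add: Ew fun_eq_iff inner_commute algebra_simps del: transpose_matrix_vector)+
  \<comment> \<open>The quadratic term in \<open>mu\<close> and the envelope combine:
    \<open>t *\<^sub>R r\<close> is \<open>t *\<^sub>R mu - v\<close>, so only \<open>v\<close>
    survives.\<close>
  have r: "t * (b \<bullet> mu) - (t *\<^sub>R b) \<bullet> r = b \<bullet> v" for b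
  proof -
    have "t *\<^sub>R r = t *\<^sub>R mu - v" using t by (simp add: r_def z_def v)
    moreover have "(t *\<^sub>R b) \<bullet> r = b \<bullet> (t *\<^sub>R r)" by simp
    ultimately show ?thesis by (simp only: inner_diff_right inner_scaleR_right)
  qed
  have w: "t * ((transpose H *v a + transpose K *v b) \<bullet> w) = a \<bullet> - (H *v d) + b \<bullet> - (K *v d)" for a b
    unfolding d w_def[symmetric] matrix_vector_mult_scaleR
    by (simp add: inner_add_left inner_transpose_matrix_vector distrib_left del: transpose_matrix_vector)
  have "t * ((transpose H *v fst p + transpose K *v snd p) \<bullet> w) + t * (snd p \<bullet> mu) - (t *\<^sub>R snd p) \<bullet> r
      = p \<bullet> (- (H *v d), v - K *v d)" for p
    using r[of "snd p"] w[of "fst p" "snd p"] unfolding inner_prod_def fst_conv snd_conv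
    by (simp only: inner_diff_right inner_minus_right)
  with der show "GDERIV (subproblem_dual f h A g t x) (lam, mu) :> (- (jacobian h (at x) *v d), v - jacobian A (at x) *v d)"
    unfolding gderiv_def H_def[symmetric] K_def[symmetric] by (simp only:)
qed

section \<open>Decrease of the penalty function\<close>

lemma norm_le_if_quadratic_le:
  fixes n b c :: real
  assumes "n * n \<le> b * n + c * c / 4" "0 \<le> b" "0 \<le> c"
  shows "n \<le> b + c / 2"
proof (rule ccontr)
  assume "\<not> ?thesis"
  then have n: "c / 2 \<le> n" "0 < n" "c / 2 < n - b" using assms by auto
  have "c / 2 * (c / 2) \<le> n * (c / 2)" using n assms by (intro mult_right_mono) auto
  also have "\<dots> < n * (n - b)" using n by (intro mult_strict_left_mono)
  finally show False using assms(1) by (simp add: algebra_simps)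
qed

text \<open>The analytic hypotheses without iteration indices, so that each estimate concerns one
  point and one step size. \<open>M_nonempty\<close> will come from the feasible starting
  point.\<close>

locale composite_problem =
  fixes M :: "(real^'n) set"
    and f :: "real^'n \<Rightarrow> real" and g :: "real^'p \<Rightarrow> real"
    and A :: "real^'n \<Rightarrow> real^'p" and h :: "real^'n \<Rightarrow> real^'m"
    and kappa theta L_h C1 C2 L_f l_g L_A l_f l_A alpha sigma :: real
  assumes f_diff: "f differentiable (at u)" and A_diff: "A differentiable (at u)"
    and h_diff: "h differentiable (at u)"
    and g_convex: "convex_on UNIV g"
    and M_eq: "M = {u. h u = 0}" and M_nonempty: "M \<noteq> {}"
    and kappa_pos: "kappa > 0" and error_bound: "infdist u M \<le> kappa * norm (h u)"
    and L_h_pos: "L_h > 0"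
    and Jh_lipschitz: "spectral_norm (jacobian h (at u) - jacobian h (at w)) \<le> L_h * norm (u - w)"
    and theta_pos: "theta > 0" and C1_pos: "0 < C1" and C1_le_C2: "C1 \<le> C2"
    and eigenvalues: "u \<in> tube M (2 * theta) \<Longrightarrow>
          eigenvalue (jacobian h (at u) ** transpose (jacobian h (at u))) e \<Longrightarrow> e \<in> {C1..C2}"
    and gradient_f_lipschitz: "L_f-lipschitz_on UNIV (gradient f)"
    and g_lipschitz: "l_g-lipschitz_on UNIV g"
    and JA_lipschitz: "spectral_norm (jacobian A (at u) - jacobian A (at w)) \<le> L_A * norm (u - w)"
    and l_f_pos: "l_f > 0" and gradient_f_le: "u \<in> tube M (2 * theta) \<Longrightarrow> norm (gradient f u) \<le> l_f"
    and l_A_pos: "l_A > 0" and JA_le: "u \<in> tube M (2 * theta) \<Longrightarrow> spectral_norm (jacobian A (at u)) \<le> l_A"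
    and alpha_pos: "alpha > 0" and sigma_pos: "sigma > 0"
begin

abbreviation Jh :: "real^'n \<Rightarrow> real^'n^'m" where "Jh u \<equiv> jacobian h (at u)"
abbreviation JA :: "real^'n \<Rightarrow> real^'n^'p" where "JA u \<equiv> jacobian A (at u)"
abbreviation Phi :: "real^'n \<Rightarrow> real" where "Phi \<equiv> exact_penalty f h A g alpha"

lemma l_g_nonneg: "0 \<le> l_g"
  using g_lipschitz lipschitz_on_nonneg by blast

lemma L_f_nonneg: "0 \<le> L_f"
  using gradient_f_lipschitz lipschitz_on_nonneg by blast

lemma L_A_nonneg: "0 \<le> L_A"
proof -
  have "0 \<le> spectral_norm (JA (axis undefined 1) - JA 0)"
    unfolding spectral_norm_def by (rule onorm_pos_le) (rule matrix_vector_mul_bounded_linear)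
  also have "\<dots> \<le> L_A * norm (axis undefined 1 - 0 :: real^'n)" by (rule JA_lipschitz)
  finally show ?thesis by (simp add: norm_axis_1)
qed

lemma f_has_derivative: "(f has_derivative (\<lambda>w. w \<bullet> gradient f u)) (at u)"
  using gradient_works[OF f_diff] by (simp add: gderiv_def)

lemma h_has_derivative: "(h has_derivative (\<lambda>w. Jh u *v w)) (at u)"
  using h_diff by (simp only: jacobian_works)

lemma A_has_derivative: "(A has_derivative (\<lambda>w. JA u *v w)) (at u)"
  using A_diff by (simp only: jacobian_works)

lemma h_linearization: "norm (h (u + w) - h u - Jh u *v w) \<le> L_h / 2 * (norm w)\<^sup>2"
proof (rule norm_linearization_error_le[OF h_has_derivative])
  show "norm (Jh b *v c - Jh u *v c) \<le> L_h * norm (b - u) * norm c" for b c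
    unfolding matrix_vector_mult_diff_rdistrib[symmetric]
    using norm_matrix_vector_le_spectral_norm Jh_lipschitz
    by (meson mult_right_mono norm_ge_zero order_trans)
qed

lemma A_linearization: "norm (A (u + w) - A u - JA u *v w) \<le> L_A / 2 * (norm w)\<^sup>2"
proof (rule norm_linearization_error_le[OF A_has_derivative])
  show "norm (JA b *v c - JA u *v c) \<le> L_A * norm (b - u) * norm c" for b c
    unfolding matrix_vector_mult_diff_rdistrib[symmetric]
    using norm_matrix_vector_le_spectral_norm JA_lipschitz
    by (meson mult_right_mono norm_ge_zero order_trans)
qed

lemma f_descent: "f (u + w) \<le> f u + w \<bullet> gradient f u + L_f / 2 * (norm w)\<^sup>2"
proof -
  have "norm (f (u + w) - f u - w \<bullet> gradient f u) \<le> L_f / 2 * (norm w)\<^sup>2"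
  proof (rule norm_linearization_error_le[OF f_has_derivative])
    show "norm (c \<bullet> gradient f b - c \<bullet> gradient f u) \<le> L_f * norm (b - u) * norm c" for b c
    proof -
      have "norm (c \<bullet> gradient f b - c \<bullet> gradient f u) \<le> norm c * norm (gradient f b - gradient f u)"
        unfolding inner_diff_right[symmetric] real_norm_def by (rule Cauchy_Schwarz_ineq2)
      also have "\<dots> \<le> norm c * (L_f * norm (b - u))"
        using lipschitz_onD[OF gradient_f_lipschitz, of b u] by (intro mult_left_mono) (auto simp: dist_norm)
      finally show ?thesis by (simp add: mult.commute)
    qed
  qed
  then show ?thesis unfolding real_norm_def by linarith
qed

text \<open>Mean value inequality. The bounds \<open>l_f\<close> and \<open>l_A\<close> hold only in
  the tube, hence the whole segment has to lie there.\<close>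

lemma objective_lipschitz_segment:
  assumes seg: "closed_segment u w \<subseteq> tube M (2 * theta)"
  shows "f w + g (A w) \<le> f u + g (A u) + (l_f + l_g * l_A) * norm (w - u)"
proof -
  have "norm (f w - f u) \<le> l_f * norm (w - u)"
  proof (rule differentiable_bound[OF convex_closed_segment])
    fix z assume "z \<in> closed_segment u w"
    then have "norm (gradient f z) \<le> l_f" using seg gradient_f_le by blast
    then show "onorm (\<lambda>w. w \<bullet> gradient f z) \<le> l_f"
      using Cauchy_Schwarz_ineq2[of _ "gradient f z"] l_f_pos
      by (intro onorm_bound) (auto, metis mult.commute mult_right_mono norm_ge_zero order_trans)
  qed (use has_derivative_at_withinI[OF f_has_derivative] in auto)
  moreover have "norm (A w - A u) \<le> l_A * norm (w - u)"
  proof (rule differentiable_bound[OF convex_closed_segment])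
    fix z assume "z \<in> closed_segment u w"
    then show "onorm (\<lambda>w. JA z *v w) \<le> l_A"
      using seg JA_le unfolding spectral_norm_def by blast
  qed (use has_derivative_at_withinI[OF A_has_derivative] in auto)
  then have "l_g * norm (A w - A u) \<le> l_g * (l_A * norm (w - u))"
    using l_g_nonneg by (intro mult_left_mono)
  moreover have "g (A w) \<le> g (A u) + l_g * norm (A w - A u)"
    using lipschitz_onD[OF g_lipschitz, of "A w" "A u"] by (simp add: dist_norm)
  ultimately show ?thesis by (simp add: algebra_simps)
qed

section \<open>Second half of the step: restoring feasibility by a gradient step or a
  projection\<close>

lemma in_tube_if_norm_h_le:
  assumes "norm (h u) \<le> theta / kappa"
  shows "infdist u M \<le> theta"
  using error_bound[of u] assms kappa_pos by (simp add: field_simps)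

lemma gradient_half_norm_h:
  "gradient (\<lambda>u. 1 / 2 * (norm (h u))\<^sup>2) y = transpose (Jh y) *v h y"
proof (rule gradient_eqI)
  have "((\<lambda>u. 1 / 2 * (h u \<bullet> h u)) has_derivative (\<lambda>w. h y \<bullet> (Jh y *v w))) (at y)"
    by (rule derivative_eq_intros h_has_derivative refl | simp add: inner_commute)+
  then show "GDERIV (\<lambda>u. 1 / 2 * (norm (h u))\<^sup>2) y :> transpose (Jh y) *v h y"
    unfolding gderiv_def power2_norm_eq_inner
    by (simp add: inner_commute[of _ "transpose (Jh y) *v h y"] inner_transpose_matrix_vector
        del: transpose_matrix_vector)
qed

text \<open>The linear part of \<open>h\<close> along the step is contracted by
  \<open>gram_contraction\<close>; the linearization error is quadratic in the step.\<close>

lemma gradient_step_feasibility: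
  assumes hy: "norm (h y) \<le> theta / kappa" and s: "0 \<le> s" "s * C2 \<le> 1"
  shows "norm (h (y - s *\<^sub>R (transpose (Jh y) *v h y)))
    \<le> (1 - s * C1) * norm (h y) + s\<^sup>2 * (L_h * C2 * (theta / kappa) / 2) * norm (h y)"
proof -
  let ?n = "transpose (Jh y) *v h y"
  have ytube: "y \<in> tube M (2 * theta)"
    using in_tube_if_norm_h_le[OF hy] theta_pos by (simp add: tube_def)
  note ev = eigenvalues[OF ytube]
  have "norm (h (y - s *\<^sub>R ?n)) \<le> norm (h y - s *\<^sub>R (Jh y *v ?n)) + L_h / 2 * (norm (s *\<^sub>R ?n))\<^sup>2"
  proof -
    have "norm (h (y - s *\<^sub>R ?n) - (h y - s *\<^sub>R (Jh y *v ?n))) \<le> L_h / 2 * (norm (s *\<^sub>R ?n))\<^sup>2"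
    proof -
      have "h (y + (- s) *\<^sub>R ?n) - h y - Jh y *v ((- s) *\<^sub>R ?n) = h (y - s *\<^sub>R ?n) - (h y - s *\<^sub>R (Jh y *v ?n))"
        unfolding matrix_vector_mult_scaleR by (simp del: transpose_matrix_vector)
      moreover have "norm ((- s) *\<^sub>R ?n) = norm (s *\<^sub>R ?n)" by simp
      ultimately show ?thesis using h_linearization[of y "(- s) *\<^sub>R ?n"] by (simp only:)
    qed
    then show ?thesis
      using norm_triangle_sub[of "h (y - s *\<^sub>R ?n)" "h y - s *\<^sub>R (Jh y *v ?n)"] by linarith
  qed
  moreover have "norm (h y - s *\<^sub>R (Jh y *v ?n)) \<le> (1 - s * C1) * norm (h y)"
    using gram_contraction[where B = "Jh y", OF ev] C1_pos C1_le_C2 s by simp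
  moreover have "L_h / 2 * (norm (s *\<^sub>R ?n))\<^sup>2 \<le> s\<^sup>2 * (L_h * C2 * (theta / kappa) / 2) * norm (h y)"
  proof -
    have "L_h / 2 * (norm (s *\<^sub>R ?n))\<^sup>2 \<le> L_h / 2 * (s\<^sup>2 * (C2 * (norm (h y))\<^sup>2))"
      using gram_upper[where B = "Jh y" and s = "h y", OF ev] L_h_pos
      by (intro mult_left_mono) (simp_all add: power_mult_distrib mult_left_mono)
    \<comment> \<open>One of the two factors \<open>norm (h y)\<close> is bounded by
      \<open>theta / kappa\<close>, so that the error stays proportional to
      \<open>norm (h y)\<close>.\<close>
    also have "\<dots> \<le> L_h / 2 * (s\<^sup>2 * (C2 * (theta / kappa * norm (h y))))"
      using mult_right_mono[OF hy norm_ge_zero[of "h y"]] L_h_pos C1_pos C1_le_C2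
      by (intro mult_left_mono) (simp_all add: power2_eq_square)
    finally show ?thesis by (simp add: mult_ac)
  qed
  ultimately show ?thesis by linarith
qed

text \<open>The objective rises by at most \<open>l_f + l_g * l_A\<close> times the step length,
  while the penalty term falls at rate \<open>alpha * C1\<close>. The first two conditions on
  \<open>tau\<close> are the two entries of \<open>tau_hat\<close>; \<open>tau_alpha\<close> is the
  other entry of \<open>tau_hat2\<close>.\<close>

lemma gradient_step_decrease:
  assumes hy: "norm (h y) \<le> theta / kappa" and tau: "0 < tau" "tau * C2 \<le> 1"
    and tau_L: "tau * (theta * L_h * C2) \<le> 2 * kappa * C1"
    and tau_alpha: "tau * (alpha * L_h * C2 * (theta / kappa) + sigma) \<le> 2 * (alpha * C1 - sqrt C2 * (l_f + l_g * l_A))"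
    and z: "z = y - tau *\<^sub>R (transpose (Jh y) *v h y)"
  shows "norm (h z) \<le> theta / kappa" and "Phi z \<le> Phi y - sigma / 2 * tau\<^sup>2 * norm (h y)"
proof -
  let ?n = "transpose (Jh y) *v h y" and ?F = "l_f + l_g * l_A" and ?c = "L_h * C2 * (theta / kappa) / 2"
  have C2_pos: "0 < C2" using C1_pos C1_le_C2 by simp
  have ytube: "y \<in> tube M (2 * theta)"
    using in_tube_if_norm_h_le[OF hy] theta_pos by (simp add: tube_def)
  have n_le: "norm ?n \<le> sqrt C2 * norm (h y)"
    using gram_upper[where B = "Jh y" and s = "h y", OF eigenvalues[OF ytube]] C2_pos
    by (auto intro!: power2_le_imp_le[of "norm ?n"] simp: power_mult_distrib simp del: transpose_matrix_vector)
  \<comment> \<open>Shorter steps do not increase \<open>norm h\<close> either, which keeps the whole segment in the tube.\<close>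
  have mono: "norm (h (y - s *\<^sub>R ?n)) \<le> theta / kappa" if s: "0 \<le> s" "s \<le> tau" for s
  proof -
    have "s * C2 \<le> 1" using mult_right_mono[OF s(2), of C2] C2_pos tau by linarith
    from gradient_step_feasibility[OF hy s(1) this]
    have "norm (h (y - s *\<^sub>R ?n)) \<le> norm (h y) - s * (C1 - s * ?c) * norm (h y)"
      by (simp add: algebra_simps power2_eq_square)
    moreover have "s * (theta * L_h * C2) \<le> 2 * kappa * C1"
      using mult_right_mono[OF s(2), of "theta * L_h * C2"] theta_pos L_h_pos C2_pos tau_L
      by (meson mult_nonneg_nonneg less_imp_le order_trans)
    then have "s * ?c \<le> C1" using kappa_pos by (simp add: field_simps)
    then have "0 \<le> s * (C1 - s * ?c) * norm (h y)" using s by simp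
    ultimately show ?thesis using hy by linarith
  qed
  then show "norm (h z) \<le> theta / kappa" unfolding z using tau by simp
  have "closed_segment y z \<subseteq> tube M (2 * theta)"
  proof
    fix w assume "w \<in> closed_segment y z"
    then obtain u where u: "0 \<le> u" "u \<le> 1" "w = (1 - u) *\<^sub>R y + u *\<^sub>R z"
      by (auto simp: closed_segment_def)
    then have "w = y - (u * tau) *\<^sub>R ?n" by (simp add: z algebra_simps)
    moreover have "u * tau \<le> tau" using u tau by (simp add: mult_left_le_one_le)
    ultimately have "infdist w M \<le> theta" using mono[of "u * tau"] in_tube_if_norm_h_le u tau by simp
    then show "w \<in> tube M (2 * theta)" using theta_pos by (simp add: tube_def)
  qed
  then have "f z + g (A z) \<le> f y + g (A y) + ?F * norm (z - y)" by (rule objective_lipschitz_segment)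
  also have "?F * norm (z - y) \<le> ?F * (tau * (sqrt C2 * norm (h y)))"
    using n_le l_f_pos l_g_nonneg l_A_pos tau by (intro mult_left_mono) (auto simp: z)
  finally have F: "f z + g (A z) \<le> f y + g (A y) + ?F * (tau * (sqrt C2 * norm (h y)))" by simp
  define c where "c = ?c"
  have "alpha * norm (h z) \<le> alpha * ((1 - tau * C1) * norm (h y) + tau\<^sup>2 * c * norm (h y))"
    using gradient_step_feasibility[OF hy, of tau] tau alpha_pos unfolding z c_def by (intro mult_left_mono) auto
  moreover have "alpha * L_h * C2 * (theta / kappa) = 2 * alpha * c" by (simp add: c_def)
  \<comment> \<open>Half of this inequality is exactly what absorbs the rise of the objective, the
    second-order error in \<open>h\<close> and the \<open>sigma\<close> term.\<close>
  with tau_alpha have "tau * norm (h y) * (tau * (2 * alpha * c + sigma))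
      \<le> tau * norm (h y) * (2 * (alpha * C1 - sqrt C2 * ?F))"
    using tau by (intro mult_left_mono) auto
  ultimately show "Phi z \<le> Phi y - sigma / 2 * tau\<^sup>2 * norm (h y)"
    using F unfolding exact_penalty_def by (simp add: power2_eq_square algebra_simps)
qed

text \<open>The projection removes the whole penalty \<open>alpha * norm (h y)\<close>, which pays
  for the rise of the objective over a distance of at most \<open>kappa * norm (h y)\<close> and for
  the \<open>sigma\<close> term. The segment stays in the tube because its points are no farther
  from \<open>z\<close> than \<open>y\<close> is.\<close>

lemma projection_step_decrease:
  assumes y: "y \<in> tube M (2 * theta)" and z: "nearest_point M y z"
    and tau: "0 < tau" "tau \<le> tau_hat"
    and alpha: "kappa * (l_f + l_g * l_A) + sigma * tau_hat\<^sup>2 / 2 \<le> alpha"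
  shows "norm (h z) \<le> theta / kappa" and "Phi z \<le> Phi y - sigma / 2 * tau\<^sup>2 * norm (h y)"
proof -
  let ?F = "l_f + l_g * l_A"
  have zM: "z \<in> M" and zmin: "\<And>w. w \<in> M \<Longrightarrow> dist y z \<le> dist y w"
    using z by (auto simp: nearest_point_def is_arg_min_linorder)
  have hz: "h z = 0" using zM M_eq by simp
  then show "norm (h z) \<le> theta / kappa" using theta_pos kappa_pos by simp
  have dist: "dist y z \<le> infdist y M"
    unfolding infdist_notempty[OF M_nonempty] using zmin M_nonempty by (intro cINF_greatest)
  have "closed_segment y z \<subseteq> tube M (2 * theta)"
  proof
    fix w assume w: "w \<in> closed_segment y z"
    have "infdist w M \<le> dist w z" using infdist_le[OF zM] .
    also have "\<dots> \<le> dist y z" using w dist_in_closed_segment[OF w] by (simp add: dist_commute)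
    finally show "w \<in> tube M (2 * theta)" using y dist by (simp add: tube_def)
  qed
  then have "f z + g (A z) \<le> f y + g (A y) + ?F * norm (z - y)" by (rule objective_lipschitz_segment)
  also have "?F * norm (z - y) \<le> ?F * (kappa * norm (h y))"
    using dist error_bound[of y] l_f_pos l_g_nonneg l_A_pos
    by (intro mult_left_mono) (auto simp: dist_norm norm_minus_commute)
  finally have F: "f z + g (A z) \<le> f y + g (A y) + ?F * (kappa * norm (h y))" by simp
  have "tau\<^sup>2 \<le> tau_hat\<^sup>2" using tau by (intro power_mono) auto
  then have "sigma * tau\<^sup>2 / 2 \<le> sigma * tau_hat\<^sup>2 / 2" using sigma_pos by simp
  then have "(kappa * ?F + sigma * tau\<^sup>2 / 2) * norm (h y) \<le> alpha * norm (h y)"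
    using alpha by (intro mult_right_mono) auto
  then show "Phi z \<le> Phi y - sigma / 2 * tau\<^sup>2 * norm (h y)"
    using F unfolding exact_penalty_def hz by (simp add: algebra_simps)
qed

section \<open>First half of the step: the direction from an inexact dual solution\<close>

context
  fixes x d :: "real^'n" and lam :: "real^'m" and mu v :: "real^'p" and t Delta :: real
  assumes x: "infdist x M \<le> theta" and t: "0 < t"
    and stationary: "norm (gradient (subproblem_dual f h A g t x) (lam, mu)) \<le> Delta"
    and d: "d = - t *\<^sub>R lagrangian_grad f h A x lam mu"
    and v: "v = prox t g (A x + t *\<^sub>R mu) - A x"
begin

lemma residual_h: "norm (Jh x *v d) \<le> Delta"
  and residual_A: "norm (v - JA x *v d) \<le> Delta"
  using stationary norm_fst_le[of "- (Jh x *v d)" "v - JA x *v d"] norm_snd_le[of "v - JA x *v d" "- (Jh x *v d)"]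
  unfolding gradient_subproblem_dual[OF g_convex g_lipschitz t d v] norm_minus_cancel by linarith+

lemma multiplier_near_subgradient: "norm (t *\<^sub>R mu - v) \<le> t * l_g"
  using prox_residual_le[OF g_convex g_lipschitz t, of "A x + t *\<^sub>R mu"] by (simp add: v algebra_simps)

lemma direction_inner:
  "d \<bullet> w = - t * (w \<bullet> gradient f x) - t * (lam \<bullet> (Jh x *v w)) - t * (mu \<bullet> (JA x *v w))"
  unfolding d lagrangian_grad_def
  by (simp add: inner_add_left inner_transpose_matrix_vector inner_commute[of "gradient f x"] algebra_simps
      del: transpose_matrix_vector)

text \<open>Test \<open>d\<close> against its tangential part. Splitting
  \<open>t *\<^sub>R mu\<close> into a bounded multiple of a subgradient plus \<open>v\<close>, and
  \<open>v\<close> into \<open>w\<close> plus a residual, produces the negative square of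
  \<open>norm w\<close>, so that no bound on \<open>mu\<close> is needed.\<close>

lemma direction_bound: "norm d \<le> t * (2 * l_f + l_g) + ((l_A + 1) / sqrt C1 + 1) * Delta"
proof -
  have xtube: "x \<in> tube M (2 * theta)" using x theta_pos by (simp add: tube_def)
  have Delta: "0 \<le> Delta" using residual_h norm_ge_zero order_trans by blast
  obtain s where s: "Jh x *v (transpose (Jh x) *v s) = Jh x *v d"
      "norm (transpose (Jh x) *v s) \<le> norm (Jh x *v d) / sqrt C1"
    using gram_right_inverse[where B = "Jh x", OF eigenvalues[OF xtube] C1_pos] by metis
  \<comment> \<open>Removing the least-norm \<open>dN\<close> with the same residual leaves a tangential part \<open>dT\<close>, to which the
      multiplier \<open>lam\<close> is blind.\<close>
  define dN where "dN = transpose (Jh x) *v s"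
  define dT where "dT = d - dN"
  define w where "w = JA x *v dT"
  define a where "a = v - w"
  have dN: "norm dN \<le> Delta / sqrt C1"
    using s(2) divide_right_mono[OF residual_h, of "sqrt C1"] C1_pos unfolding dN_def by simp
  have JdT: "Jh x *v dT = 0" using s(1) by (simp add: dT_def dN_def matrix_vector_mult_diff_distrib)
  have "norm (JA x *v dN) \<le> l_A * norm dN"
    using norm_matrix_vector_le_spectral_norm[of "JA x" dN] JA_le[OF xtube]
    by (meson mult_right_mono norm_ge_zero order_trans)
  also have "\<dots> \<le> l_A * (Delta / sqrt C1)" using dN l_A_pos by (intro mult_left_mono) auto
  finally have "norm ((v - JA x *v d) + JA x *v dN) \<le> Delta + l_A * (Delta / sqrt C1)"
    using residual_A by (intro norm_triangle_mono)
  then have a: "norm a \<le> Delta + l_A * (Delta / sqrt C1)"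
    by (simp add: a_def w_def dT_def matrix_vector_mult_diff_distrib diff_diff_eq2 add_diff_eq add.commute)
  define c where "c = t * l_g + norm a"
  have c: "0 \<le> c" using t l_g_nonneg by (simp add: c_def)
  have "norm dT * norm dT = d \<bullet> dT"
  proof -
    have "dN \<bullet> dT = 0" unfolding dN_def inner_transpose_matrix_vector JdT by simp
    then have "dT \<bullet> dT = d \<bullet> dT" by (simp add: dT_def inner_diff_left)
    then show ?thesis by (simp add: dot_square_norm power2_eq_square)
  qed
  also have "\<dots> = - t * (dT \<bullet> gradient f x) - (t *\<^sub>R mu - v) \<bullet> w - a \<bullet> w - w \<bullet> w"
    unfolding direction_inner JdT by (simp add: a_def w_def inner_diff_left)
  also have "\<dots> \<le> t * (norm dT * l_f) + c * norm w - norm w * norm w"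
  proof -
    have "- (dT \<bullet> gradient f x) \<le> norm dT * norm (gradient f x)"
      using Cauchy_Schwarz_ineq2[of dT "gradient f x"] by simp
    also have "\<dots> \<le> norm dT * l_f" using gradient_f_le[OF xtube] by (intro mult_left_mono) auto
    finally have "t * - (dT \<bullet> gradient f x) \<le> t * (norm dT * l_f)" using t by (intro mult_left_mono) auto
    moreover have "- ((t *\<^sub>R mu - v) \<bullet> w) \<le> (t * l_g) * norm w"
      using Cauchy_Schwarz_ineq2[of "t *\<^sub>R mu - v" w] mult_right_mono[OF multiplier_near_subgradient norm_ge_zero[of w]]
      by linarith
    moreover have "- (a \<bullet> w) \<le> norm a * norm w"
      using Cauchy_Schwarz_ineq2[of a w] by linarith
    ultimately show ?thesis
      by (simp add: c_def algebra_simps dot_square_norm power2_eq_square)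
  qed
  \<comment> \<open>Completing the square in \<open>norm w\<close> avoids the factor \<open>l_A * l_g\<close>.\<close>
  also have "\<dots> \<le> (t * l_f) * norm dT + c * c / 4"
    using zero_le_square[of "norm w - c / 2"] by (simp add: algebra_simps)
  finally have "norm dT \<le> t * l_f + c / 2"
    using c t l_f_pos by (intro norm_le_if_quadratic_le) auto
  moreover have "norm d \<le> norm dT + norm dN"
    using norm_triangle_ineq[of dT dN] by (simp add: dT_def)
  moreover define R where "R = Delta / sqrt C1"
  moreover define E where "E = l_A * R"
  moreover have "norm a \<le> Delta + E" "norm dN \<le> R" using a dN by (simp_all add: E_def R_def)
  moreover have "c / 2 = t * l_g / 2 + norm a / 2" by (simp add: c_def add_divide_distrib)
  \<comment> \<open>Sharper than the claim; what follows only relaxes the coefficients.\<close>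
  ultimately have "norm d \<le> t * l_f + t * l_g / 2 + Delta / 2 + E / 2 + R" by linarith
  moreover have "0 \<le> t * l_f" "0 \<le> t * l_g" "0 \<le> R" "0 \<le> E"
    using t l_f_pos l_g_nonneg l_A_pos Delta C1_pos by (auto simp: E_def R_def)
  moreover have "((l_A + 1) / sqrt C1 + 1) * Delta = E + R + Delta"
    by (simp add: E_def R_def add_divide_distrib distrib_right)
  moreover have "t * (2 * l_f + l_g) = 2 * (t * l_f) + t * l_g" by (simp add: algebra_simps)
  ultimately show ?thesis using Delta by linarith
qed

text \<open>The model change \<open>P + Q\<close> is at most \<open>- D - V\<close> up to residuals.
  Half of \<open>eta * D\<close> covers the quadratic errors of \<open>f\<close>, \<open>h\<close>,
  \<open>A\<close> and the \<open>sigma\<close> term; half of \<open>eta * V\<close> remains as the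
  decrease in \<open>v\<close>.\<close>

lemma step_decrease:
  assumes eta: "0 < eta" "eta \<le> 1" "eta * (t * (L_f + l_g * L_A + alpha * L_h + sigma)) \<le> 1"
  shows "Phi (x + eta *\<^sub>R d) \<le> Phi x - sigma / 2 * eta\<^sup>2 * (norm d)\<^sup>2 - eta / (2 * t) * (norm v)\<^sup>2
    + eta * (alpha + l_g + norm lam + norm mu) * Delta"
proof -
  let ?y = "x + eta *\<^sub>R d"
  define N where "N = eta\<^sup>2 * (norm d)\<^sup>2"
  define P where "P = d \<bullet> gradient f x"
  \<comment> \<open>An upper bound for \<open>g (A x + v) - g (A x)\<close>, from the subgradient at
    the proximal point \<open>A x + v\<close>.\<close>
  define Q where "Q = ((t *\<^sub>R mu - v) \<bullet> v) / t"
  define D where "D = (norm d)\<^sup>2 / t"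
  define V where "V = (norm v)\<^sup>2 / t"
  let ?e1 = "Jh x *v d" and ?e2 = "v - JA x *v d"
  have nN: "(norm (eta *\<^sub>R d))\<^sup>2 = N" using eta by (simp add: N_def power_mult_distrib)
  have f: "f ?y \<le> f x + eta * P + L_f / 2 * N"
    using f_descent[of x "eta *\<^sub>R d"] unfolding nN P_def by simp
  have h: "norm (h ?y) \<le> norm (h x) + eta * Delta + L_h / 2 * N"
  proof -
    have "h ?y = (h ?y - h x - Jh x *v (eta *\<^sub>R d)) + (h x + eta *\<^sub>R ?e1)"
      by (simp add: matrix_vector_mult_scaleR)
    then have "norm (h ?y) \<le> norm (h ?y - h x - Jh x *v (eta *\<^sub>R d)) + norm (h x + eta *\<^sub>R ?e1)"
      by (metis norm_triangle_ineq)
    moreover have "norm (h x + eta *\<^sub>R ?e1) \<le> norm (h x) + eta * Delta"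
      using eta residual_h by (intro norm_triangle_mono) auto
    ultimately show ?thesis using h_linearization[of x "eta *\<^sub>R d"] unfolding nN by linarith
  qed
  have g: "g (A ?y) \<le> g (A x) + eta * (Q) + l_g * (L_A / 2 * N + eta * norm ?e2)"
  proof -
    have eq: "A ?y - (A x + eta *\<^sub>R v) = (A ?y - A x - JA x *v (eta *\<^sub>R d)) - eta *\<^sub>R ?e2"
      by (simp add: matrix_vector_mult_scaleR algebra_simps)
    have "norm (eta *\<^sub>R ?e2) = eta * norm ?e2" using eta by simp
    then have "norm (A ?y - (A x + eta *\<^sub>R v)) \<le> L_A / 2 * N + eta * norm ?e2"
      using norm_triangle_ineq4[of "A ?y - A x - JA x *v (eta *\<^sub>R d)" "eta *\<^sub>R ?e2"]
        A_linearization[of x "eta *\<^sub>R d"] unfolding nN eq by linarith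
    then have "l_g * norm (A ?y - (A x + eta *\<^sub>R v)) \<le> l_g * (L_A / 2 * N + eta * norm ?e2)"
      using l_g_nonneg by (intro mult_left_mono)
    moreover have "g (A ?y) \<le> g (A x + eta *\<^sub>R v) + l_g * norm (A ?y - (A x + eta *\<^sub>R v))"
      using lipschitz_onD[OF g_lipschitz, of "A ?y" "A x + eta *\<^sub>R v"] by (simp add: dist_norm)
    moreover have "g (A x + eta *\<^sub>R v) \<le> (1 - eta) * g (A x) + eta * g (A x + v)"
    proof -
      have "A x + eta *\<^sub>R v = (1 - eta) *\<^sub>R A x + eta *\<^sub>R (A x + v)" by (simp add: algebra_simps)
      then show ?thesis using convex_onD[OF g_convex, of eta "A x" "A x + v"] eta by simp
    qed
    moreover have "eta * g (A x + v) \<le> eta * (g (A x) + Q)"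
    proof (rule mult_left_mono)
      have "A x + v = prox t g (A x + t *\<^sub>R mu)" by (simp add: v)
      then have "g (A x + v) + ((A x + t *\<^sub>R mu - (A x + v)) \<bullet> (A x - (A x + v))) / t \<le> g (A x)"
        using prox_subgradient[OF g_convex g_lipschitz t, of "A x + t *\<^sub>R mu" "A x"] by simp
      then show "g (A x + v) \<le> g (A x) + Q" by (simp add: Q_def)
    qed (use eta in simp)
    ultimately show ?thesis by (simp add: algebra_simps)
  qed
  \<comment> \<open>The \<open>mu\<close> terms of \<open>P\<close> and \<open>Q\<close> merge into
    \<open>mu \<bullet> ?e2\<close>, so the multipliers meet only residuals of size at most
    \<open>Delta\<close>.\<close>
  have model: "P + Q \<le> - D - V + (norm lam + norm mu) * Delta"
  proof -
    have "P = - D - lam \<bullet> ?e1 - mu \<bullet> (JA x *v d)"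
      using direction_inner[of d] t by (simp add: P_def D_def dot_square_norm field_simps)
    moreover have "Q = mu \<bullet> v - V"
      using t by (simp add: Q_def V_def inner_diff_left dot_square_norm diff_divide_distrib)
    moreover have "mu \<bullet> v - mu \<bullet> (JA x *v d) = mu \<bullet> ?e2" by (simp add: inner_diff_right)
    moreover have "- (lam \<bullet> ?e1) \<le> norm lam * Delta"
      using Cauchy_Schwarz_ineq2[of lam ?e1] mult_left_mono[OF residual_h norm_ge_zero[of lam]] by linarith
    moreover have "mu \<bullet> ?e2 \<le> norm mu * Delta"
      using norm_cauchy_schwarz[of mu ?e2] mult_left_mono[OF residual_A norm_ge_zero[of mu]] by linarith
    ultimately show ?thesis by (simp add: distrib_right)
  qed
  have "eta * (l_g * norm ?e2) \<le> eta * (l_g * Delta)"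
    using residual_A l_g_nonneg eta by (intro mult_left_mono) auto
  moreover have "eta * (P + Q) \<le> eta * (- D - V + (norm lam + norm mu) * Delta)"
    using model eta by (intro mult_left_mono) auto
  moreover have "alpha * norm (h ?y) \<le> alpha * (norm (h x) + eta * Delta + L_h / 2 * N)"
    using h alpha_pos by (intro mult_left_mono) auto
  \<comment> \<open>Since \<open>t * D\<close> is the square of \<open>norm d\<close>, the step-size
    condition times \<open>eta * D\<close> bounds the quadratic term \<open>N\<close>.\<close>
  moreover have "(eta * (t * (L_f + l_g * L_A + alpha * L_h + sigma))) * (eta * D) \<le> 1 * (eta * D)"
    using eta t unfolding D_def by (intro mult_right_mono) auto
  then have "(L_f + l_g * L_A + alpha * L_h + sigma) * N \<le> eta * D"
    using t by (simp add: N_def D_def power2_eq_square algebra_simps)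
  moreover have "0 \<le> eta * D" "0 \<le> eta * V" using eta t by (auto simp: D_def V_def)
  moreover have v: "eta / (2 * t) * (norm v)\<^sup>2 = eta * V / 2" by (simp add: V_def)
  moreover have "0 \<le> (L_f + l_g * L_A + alpha * L_h) * N"
    using L_f_nonneg l_g_nonneg L_A_nonneg alpha_pos L_h_pos unfolding N_def by (intro mult_nonneg_nonneg add_nonneg_nonneg) auto
  ultimately show ?thesis
    using f g unfolding exact_penalty_def v N_def[symmetric] mult.assoc[of "sigma / 2"] by (simp add: algebra_simps)
qed

end

end

section \<open>Termination of the backtracking loop\<close>

lemma power_le_if_log_le:
  fixes b r :: real
  assumes "0 < b" "b < 1" "0 < r" "log b r \<le> real j"
  shows "b ^ j \<le> r"
proof -
  have "b powr real j \<le> b powr (log b r)" using assms by (intro powr_mono') auto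
  then show ?thesis using assms by (simp add: powr_realpow)
qed

text \<open>If the first passes up to \<open>J\<close> were all rejected, both step sizes would have
  shrunk geometrically below their thresholds by pass \<open>J\<close>, which forces acceptance. The
  maximum with \<open>0\<close> covers step sizes that start below the thresholds.\<close>

lemma backtracking_terminates:
  fixes eta tau :: "nat \<Rightarrow> real"
  assumes b: "0 < b" "b < 1" and c: "0 < c" "c < 1" and init: "0 < eta 0" "0 < tau 0"
    and E: "0 < E" and S: "0 < S"
    and shrink: "\<And>j. \<forall>j'\<le>j. \<not> accepted j' \<Longrightarrow> eta (Suc j) = b * eta j \<and> tau (Suc j) = c * tau j"
    and small_accepted: "\<And>j. \<forall>j'<j. \<not> accepted j' \<Longrightarrow> 0 < eta j \<Longrightarrow> eta j \<le> E \<Longrightarrow>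
      0 < tau j \<Longrightarrow> tau j \<le> S \<Longrightarrow> accepted j"
  shows "\<exists>j. accepted j \<and> (\<forall>j'<j. \<not> accepted j') \<and>
    int j \<le> max (max \<lceil>log b (E / eta 0)\<rceil> \<lceil>log c (S / tau 0)\<rceil>) 0"
proof -
  define m where "m = max (max \<lceil>log b (E / eta 0)\<rceil> \<lceil>log c (S / tau 0)\<rceil>) 0"
  define J where "J = nat m"
  have intJ: "int J = m" by (simp add: J_def m_def)
  have "\<lceil>log b (E / eta 0)\<rceil> \<le> int J" "\<lceil>log c (S / tau 0)\<rceil> \<le> int J" by (auto simp: intJ m_def)
  then have logs: "log b (E / eta 0) \<le> real J" "log c (S / tau 0) \<le> real J"
    by (simp_all add: ceiling_le_iff)
  have "\<exists>j\<le>J. accepted j"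
  proof (rule ccontr)
    assume none: "\<not> (\<exists>j\<le>J. accepted j)"
    have "eta j = b ^ j * eta 0 \<and> tau j = c ^ j * tau 0" if "j \<le> J" for j
      using that by (induction j) (use none shrink in auto)
    then have J: "eta J = b ^ J * eta 0" "tau J = c ^ J * tau 0" by blast+
    have "b ^ J \<le> E / eta 0" "c ^ J \<le> S / tau 0"
      by (rule power_le_if_log_le; use b c E S init logs in simp)+
    then have "eta J \<le> E" "tau J \<le> S" using J init by (simp_all add: field_simps)
    moreover have "0 < eta J" "0 < tau J" using J b c init by simp_all
    ultimately have "accepted J" using none by (intro small_accepted) auto
    then show False using none by blast
  qed
  then obtain j where j: "j \<le> J" "accepted j" by blast
  \<comment> \<open>Some accepted index is not enough: the loop stops at the first one.\<close>
  define l where "l = (LEAST j. accepted j)"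
  have "accepted l" unfolding l_def by (rule LeastI) (rule j)
  moreover have "\<forall>j'<l. \<not> accepted j'" unfolding l_def using not_less_Least by blast
  moreover have "int l \<le> m"
    using Least_le[of accepted j] j unfolding l_def intJ[symmetric] by simp
  ultimately show ?thesis unfolding m_def by blast
qed

lemma C1_on_UNIV_differentiable: "C1_on UNIV F \<Longrightarrow> F differentiable (at u)"
  unfolding C1_on_def differentiable_def by blast

text \<open>Passes are counted from \<open>0\<close>, so the index of the first accepted pass equals
  the number of rejections before it.\<close>

theorem proposition4:
  fixes M :: "(real^'n) set"
    and f :: "real^'n \<Rightarrow> real" and g :: "real^'p \<Rightarrow> real"
    and A :: "real^'n \<Rightarrow> real^'p" and h :: "real^'n \<Rightarrow> real^'m"
    and kappa theta L_h C1 C2 L_f l_g L_A l_f l_A :: real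
    and gamma alpha t_min t_max Delta_max eta_max tau_max sigma :: real
    and rho :: "nat \<Rightarrow> real"
    and x d :: "nat \<Rightarrow> real^'n" and t Delta :: "nat \<Rightarrow> real"
    and lam :: "nat \<Rightarrow> real^'m" and mu v :: "nat \<Rightarrow> real^'p"
    and eta tau :: "nat \<Rightarrow> nat \<Rightarrow> real" and y xhat :: "nat \<Rightarrow> nat \<Rightarrow> real^'n"
    and accepted :: "nat \<Rightarrow> nat \<Rightarrow> bool"
    and M1 M2 tau_hat tau_hat2 eta_tilde tau_tilde :: real
    and eta_hat1 eta_hat2 :: "real \<Rightarrow> real \<Rightarrow> real"
    and k :: nat
  \<comment> \<open>the problem and its standing assumptions\<close>
  assumes "compact M" and "embedded_submanifold M"
    and "C1_on UNIV f" and "C1_on UNIV A"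
    and "convex_on UNIV g" and "closed (epigraph UNIV g)"
    and "M = {u. h u = 0}"
    and "kappa > 0" and "\<And>u. infdist u M \<le> kappa * norm (h u)"
    and "L_h > 0" and "\<And>u. h differentiable (at u)"
    and "\<And>u w. spectral_norm (jacobian h (at u) - jacobian h (at w)) \<le> L_h * norm (u - w)"
    and "theta > 0" and "0 < C1" and "C1 \<le> C2"
    and "\<And>u e. u \<in> tube M (2 * theta) \<Longrightarrow>
          eigenvalue (jacobian h (at u) ** transpose (jacobian h (at u))) e \<Longrightarrow> e \<in> {C1..C2}"
    and "L_f-lipschitz_on UNIV (gradient f)"
    and "l_g-lipschitz_on UNIV g"
    and "\<And>u w. spectral_norm (jacobian A (at u) - jacobian A (at w)) \<le> L_A * norm (u - w)"
    and "l_f > 0" and "\<And>u. u \<in> tube M (2 * theta) \<Longrightarrow> norm (gradient f u) \<le> l_f"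
    and "l_A > 0" and "\<And>u. u \<in> tube M (2 * theta) \<Longrightarrow> spectral_norm (jacobian A (at u)) \<le> l_A"
  \<comment> \<open>inputs of the algorithm\<close>
    and "x 0 \<in> M" and "0 < gamma" and "gamma < 1" and "alpha > 0"
    and "0 < t_min" and "t_min \<le> t_max"
    and "Delta_max > 0" and "eta_max > 0" and "tau_max > 0" and "sigma > 0"
    and "\<And>i. rho i \<ge> 0" and "summable rho"
  \<comment> \<open>steps 1 to 3, in all outer iterations up to \<open>k\<close>\<close>
    and "\<And>i. i \<le> k \<Longrightarrow> t i \<in> {t_min..t_max}"
    and "\<And>i. i \<le> k \<Longrightarrow> Delta i \<in> {0..Delta_max}"
    and "\<And>i. i \<le> k \<Longrightarrow>
          norm (gradient (subproblem_dual f h A g (t i) (x i)) (lam i, mu i)) \<le> Delta i"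
    and "\<And>i. i \<le> k \<Longrightarrow> d i = - t i *\<^sub>R lagrangian_grad f h A (x i) (lam i) (mu i)"
    and "\<And>i. i \<le> k \<Longrightarrow> v i = prox (t i) g (A (x i) + t i *\<^sub>R mu i) - A (x i)"
  \<comment> \<open>acceptance test for the trial point of outer iteration \<open>i\<close> after \<open>j\<close> rejections\<close>
    and "\<And>i j. accepted i j \<longleftrightarrow>
          norm (h (xhat i j)) \<le> theta / kappa \<and>
          exact_penalty f h A g alpha (xhat i j)
            \<le> exact_penalty f h A g alpha (x i)
              - sigma / 2 * ((eta i j)\<^sup>2 * (norm (d i))\<^sup>2 + (tau i j)\<^sup>2 * norm (h (y i j)))
              - eta i j / (2 * t i) * (norm (v i))\<^sup>2
              + eta i j * (alpha + l_g + norm (lam i) + norm (mu i)) * Delta i + rho i"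
  \<comment> \<open>steps 4 and 5: pass \<open>j\<close> of the inner loop is carried out iff all earlier ones rejected;
      the inner loops before outer iteration \<open>k\<close> have ended with an acceptance\<close>
    and "\<And>i. i \<le> k \<Longrightarrow> eta i 0 = eta_max \<and> tau i 0 = tau_max"
    and "\<And>i j. i \<le> k \<Longrightarrow> \<forall>j'<j. \<not> accepted i j' \<Longrightarrow>
          y i j = x i + eta i j *\<^sub>R d i \<and>
          trial_point M h theta kappa (y i j) (tau i j) (xhat i j)"
    and "\<And>i j. i \<le> k \<Longrightarrow> \<forall>j'\<le>j. \<not> accepted i j' \<Longrightarrow>
          eta i (Suc j) = gamma * eta i j \<and> tau i (Suc j) = gamma / 2 * tau i j"
    and "\<And>i. i < k \<Longrightarrow>
          \<exists>j. accepted i j \<and> (\<forall>j'<j. \<not> accepted i j') \<and> x (Suc i) = xhat i j"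
  \<comment> \<open>constants and the condition on the penalty parameter\<close>
    and "M1 = sqrt C2 * (l_f + l_g * l_A)"
    and "M2 = kappa * (l_f + l_g * l_A)"
    and "tau_hat = min (2 * kappa * C1 / (theta * L_h * C2)) (1 / C2)"
    and "alpha > max (M1 / C1) (M2 + sigma * tau_hat\<^sup>2 / 2)"
    and "\<And>s D. s > 0 \<Longrightarrow> D \<ge> 0 \<Longrightarrow> eta_hat1 s D =
          min (theta / (s * (2 * l_f + l_g) + ((l_A + 1) / sqrt C1 + 1) * D)) 1"
    and "\<And>s D. s > 0 \<Longrightarrow> D \<ge> 0 \<Longrightarrow> eta_hat2 s D =
          min (eta_hat1 s D) (1 / (s * (L_f + l_g * L_A + alpha * L_h + sigma)))"
    and "tau_hat2 =
          min tau_hat (2 * (alpha * C1 - M1) / (alpha * L_h * C2 * (theta / kappa) + sigma))"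
    and "eta_tilde = gamma * eta_hat2 t_max Delta_max"
    and "tau_tilde = gamma / 2 * tau_hat2"
  shows "\<exists>j. accepted k j \<and> (\<forall>j'<j. \<not> accepted k j') \<and>
          int j \<le> max (max \<lceil>log gamma (eta_tilde / eta_max)\<rceil>
                            \<lceil>log (gamma / 2) (tau_tilde / tau_max)\<rceil>) 0"
proof -
  interpret composite_problem M f g A h kappa theta L_h C1 C2 L_f l_g L_A l_f l_A alpha sigma
    by unfold_locales (use assms(3-23,24,27,33) C1_on_UNIV_differentiable in auto)
  have C2: "0 < C2" using assms(14,15) by linarith
  have tk: "0 < t k" "t k \<le> t_max" and Delta_k: "0 \<le> Delta k" "Delta k \<le> Delta_max"
    using assms(28) assms(36)[of k] assms(37)[of k] by auto
  have t_max: "0 < t_max" using tk by linarith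
  \<comment> \<open>The bound on \<open>h\<close> in the acceptance test exists for this: with the
    error bound it keeps every iterate within \<open>theta\<close> of \<open>M\<close>.\<close>
  have xk: "infdist (x k) M \<le> theta"
  proof (cases k)
    case 0
    then show ?thesis using \<open>x 0 \<in> M\<close> theta_pos by simp
  next
    case (Suc i)
    then obtain j where "accepted i j" "x k = xhat i j" using assms(45)[of i] by auto
    then show ?thesis using assms(41) in_tube_if_norm_h_le by simp
  qed
  note grad = assms(38)[OF order_refl[of k]] and dk = assms(39)[OF order_refl[of k]]
    and vk = assms(40)[OF order_refl[of k]]

  define B where "B = (l_A + 1) / sqrt C1 + 1"
  define L where "L = L_f + l_g * L_A + alpha * L_h + sigma"
  have B: "0 < B" using l_A_pos C1_pos by (simp add: B_def add_pos_pos)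
  have L: "0 < L" using L_f_nonneg l_g_nonneg L_A_nonneg alpha_pos L_h_pos sigma_pos
    by (simp add: L_def add_nonneg_pos)
  have W: "0 < t_max * (2 * l_f + l_g) + B * Delta_max"
    using t_max l_f_pos l_g_nonneg B \<open>Delta_max > 0\<close> by (simp add: add_pos_pos add_pos_nonneg)
  have eta_hat2_eq: "eta_hat2 t_max Delta_max
      = min (min (theta / (t_max * (2 * l_f + l_g) + B * Delta_max)) 1) (1 / (t_max * L))"
    using assms(50,51)[of t_max Delta_max] t_max \<open>Delta_max > 0\<close> by (simp add: B_def L_def)
  have eta_hat2_pos: "0 < eta_hat2 t_max Delta_max"
    unfolding eta_hat2_eq using W theta_pos t_max L by simp
  have eta_tilde: "0 < eta_tilde" "eta_tilde \<le> eta_hat2 t_max Delta_max"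
    using assms(53) eta_hat2_pos assms(25,26) by (simp_all add: mult_left_le_one_le)

  define c where "c = alpha * L_h * C2 * (theta / kappa) + sigma"
  have c: "0 < c"
    using alpha_pos L_h_pos C2 theta_pos kappa_pos sigma_pos by (simp add: c_def add_pos_pos)
  have alpha_C1: "0 < alpha * C1 - M1" and alpha_M2: "M2 + sigma * tau_hat\<^sup>2 / 2 \<le> alpha"
    using assms(49) C1_pos by (simp_all add: pos_divide_less_eq)
  have tau_hat_pos: "0 < tau_hat"
    unfolding assms(48) using kappa_pos C1_pos theta_pos L_h_pos C2 by simp
  have tau_hat2_pos: "0 < tau_hat2"
    unfolding assms(52) c_def[symmetric] using tau_hat_pos alpha_C1 c by simp
  have tau_tilde: "0 < tau_tilde" "tau_tilde \<le> tau_hat2"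
    unfolding assms(54) using tau_hat2_pos assms(25,26)
    by (auto intro!: mult_left_le_one_le)

  have "\<exists>j. accepted k j \<and> (\<forall>j'<j. \<not> accepted k j') \<and>
      int j \<le> max (max \<lceil>log gamma (eta_tilde / eta k 0)\<rceil> \<lceil>log (gamma / 2) (tau_tilde / tau k 0)\<rceil>) 0"
  proof (rule backtracking_terminates)
    show "eta k (Suc j) = gamma * eta k j \<and> tau k (Suc j) = gamma / 2 * tau k j"
      if "\<forall>j'\<le>j. \<not> accepted k j'" for j
      using assms(44) that by blast
  next
    fix j
    assume rejected: "\<forall>j'<j. \<not> accepted k j'"
      and eta: "0 < eta k j" "eta k j \<le> eta_tilde" and tau: "0 < tau k j" "tau k j \<le> tau_tilde"
    have y: "y k j = x k + eta k j *\<^sub>R d k" and trial: "trial_point M h theta kappa (y k j) (tau k j) (xhat k j)"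
      using assms(43)[OF order_refl rejected] by auto
    have eta': "eta k j \<le> theta / (t_max * (2 * l_f + l_g) + B * Delta_max)" "eta k j \<le> 1" "eta k j \<le> 1 / (t_max * L)"
      using eta eta_tilde unfolding eta_hat2_eq by auto
    have "norm (d k) \<le> t k * (2 * l_f + l_g) + B * Delta k"
      unfolding B_def by (rule direction_bound[OF xk tk(1) grad dk vk])
    \<comment> \<open>The bound is monotone in \<open>t\<close> and \<open>Delta\<close>, so the
      threshold at the extreme values serves every outer iteration.\<close>
    also have "\<dots> \<le> t_max * (2 * l_f + l_g) + B * Delta_max"
      using tk Delta_k B l_f_pos l_g_nonneg by (intro add_mono mult_left_mono mult_right_mono) auto
    finally have "eta k j * norm (d k) \<le> eta k j * (t_max * (2 * l_f + l_g) + B * Delta_max)"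
      using eta by (intro mult_left_mono) auto
    also have "\<dots> \<le> theta" using eta'(1) W by (simp add: pos_le_divide_eq)
    finally have step: "eta k j * norm (d k) \<le> theta" .
    \<comment> \<open>One \<open>theta\<close> is spent on the iterate and one on the step, which
      explains the tube of radius \<open>2 * theta\<close>.\<close>
    have "infdist (y k j) M \<le> infdist (x k) M + dist (y k j) (x k)" by (rule infdist_triangle)
    also have "\<dots> \<le> 2 * theta" using xk step eta by (simp add: y dist_norm)
    finally have ytube: "y k j \<in> tube M (2 * theta)" by (simp add: tube_def)

    have "eta k j * (t k * L) \<le> eta k j * (t_max * L)"
      using eta tk L by (intro mult_left_mono mult_right_mono) auto
    also have "\<dots> \<le> 1" using eta'(3) t_max L by (simp add: pos_le_divide_eq)
    finally have "Phi (y k j) \<le> Phi (x k) - sigma / 2 * (eta k j)\<^sup>2 * (norm (d k))\<^sup>2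
        - eta k j / (2 * t k) * (norm (v k))\<^sup>2
        + eta k j * (alpha + l_g + norm (lam k) + norm (mu k)) * Delta k"
      unfolding y L_def by (intro step_decrease[OF xk tk(1) grad dk vk eta(1) eta'(2)])
    moreover have "norm (h (xhat k j)) \<le> theta / kappa \<and>
        Phi (xhat k j) \<le> Phi (y k j) - sigma / 2 * (tau k j)\<^sup>2 * norm (h (y k j))"
    proof (cases "norm (h (y k j)) \<le> theta / kappa")
      case True
      have le: "tau k j \<le> tau_hat2" using tau tau_tilde by linarith
      have "tau k j * C2 \<le> 1"
        using le C2 unfolding assms(52,48) by (simp add: pos_le_divide_eq)
      moreover have "tau k j * (theta * L_h * C2) \<le> 2 * kappa * C1"
        using le C2 theta_pos L_h_pos unfolding assms(52,48) by (simp add: pos_le_divide_eq)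
      moreover have "tau k j * c \<le> 2 * (alpha * C1 - M1)"
        using le c unfolding assms(52) c_def[symmetric] by (simp add: pos_le_divide_eq)
      moreover have "xhat k j = y k j - tau k j *\<^sub>R (transpose (Jh (y k j)) *v h (y k j))"
        using trial True unfolding trial_point_def gradient_half_norm_h by simp
      ultimately show ?thesis
        using gradient_step_decrease[OF True tau(1)] unfolding c_def assms(46) by blast
    next
      case False
      then have "nearest_point M (y k j) (xhat k j)" using trial unfolding trial_point_def by simp
      moreover have "tau k j \<le> tau_hat" using tau tau_tilde assms(52) by linarith
      ultimately show ?thesis
        using projection_step_decrease[OF ytube _ tau(1)] alpha_M2 unfolding assms(47) by blast
    qed
    \<comment> \<open>The decreases of the two halves add up to the acceptance test with
      \<open>rho k\<close> to spare.\<close>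
    ultimately show "accepted k j"
      unfolding assms(41) using \<open>\<And>i. rho i \<ge> 0\<close>[of k] by (simp add: algebra_simps)
  qed (use assms(25,26,31,32) assms(42)[of k] eta_tilde tau_tilde in auto)
  then show ?thesis using assms(42)[of k] by simp
qed

end
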